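(* If $m$ changes sign in $[T_1,T_2]$, then there exists $\epsilon>0$ such that $$\Sigma^*\subset(]\lambda_1^m+\epsilon,+\infty[\times]\lambda_1^m+\epsilon,+\infty[)\cup(]-\infty,\lambda_{-1}^m-\epsilon[\times]-\infty,\lambda_{-1}^m-\epsilon[)$$ $$\cup(]-\infty,\lambda_{-1}^m-\epsilon[\times]\lambda_1^m+\epsilon,+\infty[)\cup(]\lambda_1^m+\epsilon,+\infty[\times]-\infty,\lambda_{-1}^m-\epsilon[).$$ If $m$ keeps a constant sign in $[T_1,T_2]$, then there exists $\epsilon>0$ such that $$\Sigma^*\subset\,]\lambda_1^m+\epsilon,+\infty[\times]\lambda_1^m+\epsilon,+\infty[$$ when $m\ge0$, $m\not\equiv0$ (and, correspondingly, $\Sigma^*\subset\,]-\infty,\lambda_{-1}^m-\epsilon[\times]-\infty,\lambda_{-1}^m-\epsilon[$ when $m\le0$, $m\not\equiv0$).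
   Context: Let $T_1<T_2$ be real numbers, $p,q,m\in C[T_1,T_2]$ with $p(t)>0$ and $q(t)\ge 0$ on $[T_1,T_2]$, $m\not\equiv 0$, and $Lu:=-[p(t)u']'+q(t)u$. For a function $w$, write $w^\pm:=\max\{\pm w,0\}$. "$m$ changes sign" means $m^+\not\equiv0$ and $m^-\not\equiv0$ in $[T_1,T_2]$. Consider $$Lu=m(t)[au^+-bu^-]\ \text{in } ]T_1,T_2[,\qquad u'(T_1)=0=u'(T_2).\qquad(P)$$ For $k\ge0$, $C_k^>$ (resp. $C_k^<$) is the set of $(a,b)\in\mathbb{R}^2$ such that $(P)$ has a nontrivial solution with exactly $k$ zeros in $]T_1,T_2[$ and with $u(T_2)>0$ (resp. $u(T_2)<0$). Put $\Sigma^*:=\bigcup_{k\ge1}(C_k^>\cup C_k^<)$. A principal eigenvalue of $Lu=\lambda m(t)u$ in $]T_1,T_2[$, $u'(T_1)=0=u'(T_2)$, is a real $\lambda$ having an eigenfunction without zeros. When $m^+\not\equiv0$, $\lambda_1^m$ denotes the principal positive eigenvalue, i.e. the largest principal eigenvalue (one has $\lambda_1^m\ge0$, the value $0$ being possible when $q\equiv0$); when $m^-\not\equiv0$, $\lambda_{-1}^m$ denotes the principal negative eigenvalue, i.e. the smallest principal eigenvalue (one has $\lambda_{-1}^m\le0$, the value $0$ being possible when $q\equiv0$). *)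

theory Defs
  imports "HOL-Analysis.Analysis"
begin

definition pos_part :: "(real \<Rightarrow> real) \<Rightarrow> real \<Rightarrow> real" where
  "pos_part w t = max (w t) 0"

definition neg_part :: "(real \<Rightarrow> real) \<Rightarrow> real \<Rightarrow> real" where
  "neg_part w t = max (- w t) 0"

definition not_identically_zero :: "real \<Rightarrow> real \<Rightarrow> (real \<Rightarrow> real) \<Rightarrow> bool" where
  "not_identically_zero T1 T2 w \<longleftrightarrow> (\<exists>t\<in>{T1..T2}. w t \<noteq> 0)"

definition changes_sign :: "real \<Rightarrow> real \<Rightarrow> (real \<Rightarrow> real) \<Rightarrow> bool" where
  "changes_sign T1 T2 m \<longleftrightarrow>
     not_identically_zero T1 T2 (pos_part m) \<and> not_identically_zero T1 T2 (neg_part m)"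

text \<open>Classical solutions of \<open>- (p u')' + q u = f\<close> in the open interval with Neumann
  conditions.  As \<open>p\<close> is only continuous, \<open>u\<close> need not be twice differentiable: the
  requirement is that \<open>u\<close> is \<open>C\<^sup>1\<close> on the closed interval (one-sided derivatives at the end
  points) and that \<open>p u'\<close> is differentiable inside.\<close>

definition neumann_solution ::
  "real \<Rightarrow> real \<Rightarrow> (real \<Rightarrow> real) \<Rightarrow> (real \<Rightarrow> real) \<Rightarrow> (real \<Rightarrow> real) \<Rightarrow> (real \<Rightarrow> real) \<Rightarrow> bool" where
  "neumann_solution T1 T2 p q f u \<longleftrightarrow>
     (\<exists>u'. (\<forall>t\<in>{T1..T2}. (u has_real_derivative u' t) (at t within {T1..T2})) \<and>
           continuous_on {T1..T2} u' \<and>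
           (\<forall>t\<in>{T1<..<T2}. \<exists>D. ((\<lambda>s. p s * u' s) has_real_derivative D) (at t) \<and>
                              - D + q t * u t = f t) \<and>
           u' T1 = 0 \<and> u' T2 = 0)"

definition problem_P_solution ::
  "real \<Rightarrow> real \<Rightarrow> (real \<Rightarrow> real) \<Rightarrow> (real \<Rightarrow> real) \<Rightarrow> (real \<Rightarrow> real) \<Rightarrow> real \<Rightarrow> real
    \<Rightarrow> (real \<Rightarrow> real) \<Rightarrow> bool" where
  "problem_P_solution T1 T2 p q m a b u \<longleftrightarrow>
     neumann_solution T1 T2 p q (\<lambda>t. m t * (a * pos_part u t - b * neg_part u t)) u"

definition has_exactly_zeros :: "real \<Rightarrow> real \<Rightarrow> (real \<Rightarrow> real) \<Rightarrow> nat \<Rightarrow> bool" where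
  "has_exactly_zeros T1 T2 u k \<longleftrightarrow>
     finite {t\<in>{T1<..<T2}. u t = 0} \<and> card {t\<in>{T1<..<T2}. u t = 0} = k"

definition C_gt ::
  "real \<Rightarrow> real \<Rightarrow> (real \<Rightarrow> real) \<Rightarrow> (real \<Rightarrow> real) \<Rightarrow> (real \<Rightarrow> real) \<Rightarrow> nat \<Rightarrow> (real \<times> real) set" where
  "C_gt T1 T2 p q m k =
     {(a, b). \<exists>u. problem_P_solution T1 T2 p q m a b u \<and> not_identically_zero T1 T2 u \<and>
                  has_exactly_zeros T1 T2 u k \<and> u T2 > 0}"

definition C_lt ::
  "real \<Rightarrow> real \<Rightarrow> (real \<Rightarrow> real) \<Rightarrow> (real \<Rightarrow> real) \<Rightarrow> (real \<Rightarrow> real) \<Rightarrow> nat \<Rightarrow> (real \<times> real) set" where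
  "C_lt T1 T2 p q m k =
     {(a, b). \<exists>u. problem_P_solution T1 T2 p q m a b u \<and> not_identically_zero T1 T2 u \<and>
                  has_exactly_zeros T1 T2 u k \<and> u T2 < 0}"

definition Sigma_star ::
  "real \<Rightarrow> real \<Rightarrow> (real \<Rightarrow> real) \<Rightarrow> (real \<Rightarrow> real) \<Rightarrow> (real \<Rightarrow> real) \<Rightarrow> (real \<times> real) set" where
  "Sigma_star T1 T2 p q m = (\<Union>k\<in>{1..}. C_gt T1 T2 p q m k \<union> C_lt T1 T2 p q m k)"

definition principal_eigenvalue ::
  "real \<Rightarrow> real \<Rightarrow> (real \<Rightarrow> real) \<Rightarrow> (real \<Rightarrow> real) \<Rightarrow> (real \<Rightarrow> real) \<Rightarrow> real \<Rightarrow> bool" where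
  "principal_eigenvalue T1 T2 p q m \<mu> \<longleftrightarrow>
     (\<exists>u. neumann_solution T1 T2 p q (\<lambda>t. \<mu> * m t * u t) u \<and> (\<forall>t\<in>{T1..T2}. u t \<noteq> 0))"

text \<open>The following two values are meaningful only where the maximum, respectively the minimum,
  exists: the first for \<open>m\<^sup>+\<close>, the second for \<open>m\<^sup>-\<close> not identically zero.\<close>

definition lambda_pos ::
  "real \<Rightarrow> real \<Rightarrow> (real \<Rightarrow> real) \<Rightarrow> (real \<Rightarrow> real) \<Rightarrow> (real \<Rightarrow> real) \<Rightarrow> real" where
  "lambda_pos T1 T2 p q m = (GREATEST \<mu>. principal_eigenvalue T1 T2 p q m \<mu>)"

definition lambda_neg ::
  "real \<Rightarrow> real \<Rightarrow> (real \<Rightarrow> real) \<Rightarrow> (real \<Rightarrow> real) \<Rightarrow> (real \<Rightarrow> real) \<Rightarrow> real" where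
  "lambda_neg T1 T2 p q m = (LEAST \<mu>. principal_eigenvalue T1 T2 p q m \<mu>)"

end

(*
  With v = p u' the equation L u = kappa m u is the planar system u' = v/p, v' = (q - kappa m) u.
  Call kappa subcritical if the solution with u(T1) = 1, u'(T1) = 0 is positive on [T1,T2] and
  u'(T2) >= 0.  Geometric means of positive solutions are supersolutions, so the subcritical
  parameters form an interval; it contains 0, is bounded above where m is positive somewhere
  (Riccati equation), and continuity in kappa shows that its maximum has u'(T2) = 0, so that it is
  lambda_pos.  For subcritical kappa the solutions starting from T1 and from T2 are both positive on
  [T1,T2], which is an open condition on kappa and hence persists slightly beyond the extremal
  values.  On the other hand, on a nodal interval of a sign-changing solution of (P) the Wronskian
  with one of these two positive solutions vanishes somewhere, which is impossible.
*)
theory Submission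
  imports Defs
begin

subsection \<open>Planar linear systems\<close>

text \<open>Subcriticality of \<kappa> means that the lowest Neumann eigenvalue of L - \<kappa> m is
  nonnegative, phrased through one initial value problem so that no spectral theory enters; that
  eigenvalue is concave in \<kappa>, whence an interval. Subcriticality fails immediately beyond the
  extremal values, so by itself it yields only strict inequalities. The uniform \<epsilon> comes
  from dropping the condition at the far end: bare positivity survives a small change of \<kappa>.
  Both shooting directions are kept because a nodal interval may touch T1 or T2, and the comparison
  function must satisfy the Neumann condition there. A second obstacle is (P) itself: along a fixed
  u it is a linear equation, but with a weight that may jump at the zeros of u. Uniqueness is
  therefore derived for bounded coefficients from an energy estimate; the same estimate with a
  forcing term gives Lipschitz dependence on \<kappa>.\<close>

text \<open>\<open>v\<close> stands for \<open>p u'\<close>, which \<open>neumann_solution\<close>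
  differentiates only in the open interval; hence the two ranges of \<open>t\<close>.\<close>

definition lin_sol ::
  "real \<Rightarrow> real \<Rightarrow> (real \<Rightarrow> real) \<Rightarrow> (real \<Rightarrow> real) \<Rightarrow> (real \<Rightarrow> real) \<Rightarrow> (real \<Rightarrow> real) \<Rightarrow> bool" where
  "lin_sol a b \<alpha> \<beta> u v \<longleftrightarrow>
     (\<forall>t\<in>{a..b}. (u has_real_derivative \<alpha> t * v t) (at t within {a..b})) \<and>
     continuous_on {a..b} v \<and>
     (\<forall>t\<in>{a<..<b}. (v has_real_derivative \<beta> t * u t) (at t))"

lemma DERIV_within_Icc_imp_at:
  fixes t :: real
  assumes "(f has_real_derivative D) (at t within {a..b})" "t \<in> {a<..<b}"
  shows "(f has_real_derivative D) (at t)"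
  using assms by (simp add: at_within_Icc_at)

lemma lin_solD:
  assumes "lin_sol a b \<alpha> \<beta> u v"
  shows "continuous_on {a..b} u" "continuous_on {a..b} v"
    "\<And>t. t \<in> {a<..<b} \<Longrightarrow> (u has_real_derivative \<alpha> t * v t) (at t)"
    "\<And>t. t \<in> {a<..<b} \<Longrightarrow> (v has_real_derivative \<beta> t * u t) (at t)"
    "\<And>t. t \<in> {a..b} \<Longrightarrow> (u has_real_derivative \<alpha> t * v t) (at t within {a..b})"
proof -
  show *: "(u has_real_derivative \<alpha> t * v t) (at t within {a..b})" if "t \<in> {a..b}" for t
    using assms that unfolding lin_sol_def by blast
  show "continuous_on {a..b} u"
    using * DERIV_continuous continuous_on_eq_continuous_within by blast
  show "(u has_real_derivative \<alpha> t * v t) (at t)" if "t \<in> {a<..<b}" for t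
    using DERIV_within_Icc_imp_at[OF *] that by simp
qed (use assms in \<open>auto simp: lin_sol_def\<close>)

lemma lin_sol_subinterval:
  assumes "lin_sol a b \<alpha> \<beta> u v" "a \<le> c" "d \<le> b"
  shows "lin_sol c d \<alpha> \<beta> u v"
proof -
  have sub: "{c..d} \<subseteq> {a..b}" using assms by auto
  show ?thesis
    unfolding lin_sol_def
  proof (intro conjI ballI)
    fix t assume "t \<in> {c..d}"
    with sub show "(u has_real_derivative \<alpha> t * v t) (at t within {c..d})"
      using lin_solD(5)[OF assms(1)] DERIV_subset by blast
  next
    show "continuous_on {c..d} v"
      using lin_solD(2)[OF assms(1)] sub continuous_on_subset by blast
  next
    fix t assume "t \<in> {c<..<d}"
    with assms(2,3) show "(v has_real_derivative \<beta> t * u t) (at t)"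
      using lin_solD(4)[OF assms(1)] by simp
  qed
qed

text \<open>Lets a weight that depends on the sign of \<open>u\<close> be replaced by a constant one
  on an interval where that sign is fixed.\<close>

lemma lin_sol_cong:
  assumes "lin_sol a b \<alpha> \<beta> u v" "\<And>t. t \<in> {a<..<b} \<Longrightarrow> \<beta> t * u t = \<beta>' t * u t"
  shows "lin_sol a b \<alpha> \<beta>' u v"
  using assms unfolding lin_sol_def by simp

lemma lin_sol_scale:
  assumes "lin_sol a b \<alpha> \<beta> u v"
  shows "lin_sol a b \<alpha> \<beta> (\<lambda>t. c * u t) (\<lambda>t. c * v t)"
  unfolding lin_sol_def
proof (intro conjI ballI)
  show "continuous_on {a..b} (\<lambda>t. c * v t)"
    using lin_solD(2)[OF assms] by (intro continuous_intros)
qed (use lin_solD(4,5)[OF assms] in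
      \<open>auto intro!: DERIV_cong[OF DERIV_cmult] simp: mult_ac\<close>)

section \<open>Existence by successive approximation\<close>

text \<open>Term \<open>n\<close> is the n-th increment of the successive approximations starting at
  \<open>(1, 0)\<close>, not the n-th iterate; the solution is the sum of all terms.\<close>

primrec picard ::
  "real \<Rightarrow> (real \<Rightarrow> real) \<Rightarrow> (real \<Rightarrow> real) \<Rightarrow> nat \<Rightarrow> (real \<Rightarrow> real) \<times> (real \<Rightarrow> real)" where
  "picard a \<alpha> \<beta> 0 = ((\<lambda>t. 1), (\<lambda>t. 0))"
| "picard a \<alpha> \<beta> (Suc n) =
     ((\<lambda>t. integral {a..t} (\<lambda>s. \<alpha> s * snd (picard a \<alpha> \<beta> n) s)),
      (\<lambda>t. integral {a..t} (\<lambda>s. \<beta> s * fst (picard a \<alpha> \<beta> n) s)))"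

lemma continuous_on_integral_upper_limit:
  fixes g :: "real \<Rightarrow> real"
  assumes "continuous_on {a..b} g"
  shows "continuous_on {a..b} (\<lambda>t. integral {a..t} g)"
  by (rule indefinite_integral_continuous_1[OF integrable_continuous_real[OF assms]])

text \<open>The inductive step of the factorial bound: \<open>G\<close> is the primitive of the
  bound on \<open>g\<close> that vanishes at \<open>a\<close>.\<close>

lemma integral_power_bound:
  fixes g :: "real \<Rightarrow> real"
  assumes "continuous_on {a..t} g" "a \<le> t" "0 \<le> K"
    and "\<And>s. s \<in> {a..t} \<Longrightarrow> \<bar>g s\<bar> \<le> K * ((K * (s - a)) ^ n / fact n)"
  shows "\<bar>integral {a..t} g\<bar> \<le> (K * (t - a)) ^ Suc n / fact (Suc n)"
proof -
  define G where "G s = (K * (s - a)) ^ Suc n / fact (Suc n)" for s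
  have "(G has_real_derivative K * ((K * (s - a)) ^ n / fact n)) (at s within {a..t})" for s
    unfolding G_def by (rule derivative_eq_intros refl | simp del: of_nat_Suc)+
  then have "((\<lambda>s. K * ((K * (s - a)) ^ n / fact n)) has_integral G t - G a) {a..t}"
    using assms(2)
    by (intro fundamental_theorem_of_calculus)
       (auto simp: has_real_derivative_iff_has_vector_derivative)
  then have hi: "((\<lambda>s. K * ((K * (s - a)) ^ n / fact n)) has_integral G t) {a..t}"
    by (simp add: G_def)
  have "norm (integral {a..t} g) \<le> integral {a..t} (\<lambda>s. K * ((K * (s - a)) ^ n / fact n))"
    using assms(4) hi integrable_continuous_real[OF assms(1)]
    by (intro integral_norm_bound_integral) auto
  also have "\<dots> = G t" using hi by (rule integral_unique)
  finally show ?thesis by (simp add: G_def)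
qed

lemma picard_bound:
  assumes c: "continuous_on {a..b} \<alpha>" "continuous_on {a..b} \<beta>"
    and K: "\<And>t. t \<in> {a..b} \<Longrightarrow> \<bar>\<alpha> t\<bar> \<le> K" "\<And>t. t \<in> {a..b} \<Longrightarrow> \<bar>\<beta> t\<bar> \<le> K" "0 \<le> K"
  shows "continuous_on {a..b} (fst (picard a \<alpha> \<beta> n)) \<and> continuous_on {a..b} (snd (picard a \<alpha> \<beta> n)) \<and>
    (\<forall>t\<in>{a..b}. \<bar>fst (picard a \<alpha> \<beta> n) t\<bar> \<le> (K * (t - a)) ^ n / fact n \<and>
                \<bar>snd (picard a \<alpha> \<beta> n) t\<bar> \<le> (K * (t - a)) ^ n / fact n)"
proof (induction n)
  case 0
  then show ?case by auto
next
  case (Suc n)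
  let ?f = "fst (picard a \<alpha> \<beta> n)" and ?g = "snd (picard a \<alpha> \<beta> n)"
  have cont: "continuous_on {a..b} (\<lambda>s. \<alpha> s * ?g s)" "continuous_on {a..b} (\<lambda>s. \<beta> s * ?f s)"
    using Suc c by (auto intro!: continuous_intros)
  have "\<bar>fst (picard a \<alpha> \<beta> (Suc n)) t\<bar> \<le> (K * (t - a)) ^ Suc n / fact (Suc n) \<and>
        \<bar>snd (picard a \<alpha> \<beta> (Suc n)) t\<bar> \<le> (K * (t - a)) ^ Suc n / fact (Suc n)"
    if t: "t \<in> {a..b}" for t
  proof -
    have sub: "{a..t} \<subseteq> {a..b}" using t by auto
    have "\<bar>integral {a..t} (\<lambda>s. \<alpha> s * ?g s)\<bar> \<le> (K * (t - a)) ^ Suc n / fact (Suc n)"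
      using t sub Suc K continuous_on_subset[OF cont(1) sub]
      by (intro integral_power_bound) (auto simp: abs_mult intro!: mult_mono simp del: times_divide_eq_right)
    moreover have "\<bar>integral {a..t} (\<lambda>s. \<beta> s * ?f s)\<bar> \<le> (K * (t - a)) ^ Suc n / fact (Suc n)"
      using t sub Suc K continuous_on_subset[OF cont(2) sub]
      by (intro integral_power_bound) (auto simp: abs_mult intro!: mult_mono simp del: times_divide_eq_right)
    ultimately show ?thesis by simp
  qed
  with cont show ?case by (simp add: continuous_on_integral_upper_limit)
qed

text \<open>The derivatives converge uniformly by the M-test, so the series may be differentiated
  term by term; at \<open>a\<close> all primitives vanish, which anchors the convergence.\<close>

lemma series_of_primitives:
  fixes \<gamma> :: "real \<Rightarrow> real"
  assumes "a \<le> b" and \<gamma>: "continuous_on {a..b} \<gamma>"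
    and h: "\<And>n. continuous_on {a..b} (h n)" "\<And>n t. t \<in> {a..b} \<Longrightarrow> \<bar>h n t\<bar> \<le> M n"
    and "summable M"
  shows "\<exists>w. \<forall>t\<in>{a..b}. (\<lambda>n. integral {a..t} (\<lambda>s. \<gamma> s * h n s)) sums w t \<and>
           (w has_real_derivative \<gamma> t * (\<Sum>n. h n t)) (at t within {a..b})"
proof (rule has_field_derivative_series)
  show "((\<lambda>t. integral {a..t} (\<lambda>s. \<gamma> s * h n s)) has_real_derivative \<gamma> t * h n t) (at t within {a..b})"
    if "t \<in> {a..b}" for n t
    using that \<gamma> h(1)[of n] by (intro integral_has_real_derivative) (auto intro!: continuous_intros)
  obtain B where B: "0 \<le> B" "\<And>t. t \<in> {a..b} \<Longrightarrow> norm (\<gamma> t) \<le> B"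
    using continuous_on_compact_bound[OF compact_Icc \<gamma>] by blast
  have "uniform_limit {a..b} (\<lambda>n t. \<Sum>i<n. \<gamma> t * h i t) (\<lambda>t. \<Sum>n. \<gamma> t * h n t) sequentially"
  proof (rule Weierstrass_m_test)
    show "norm (\<gamma> t * h n t) \<le> B * M n" if "t \<in> {a..b}" for n t
      using B h(2)[OF that] that by (auto simp: abs_mult intro!: mult_mono)
    show "summable (\<lambda>n. B * M n)" using \<open>summable M\<close> by (rule summable_mult)
  qed
  moreover have "(\<Sum>n. \<gamma> t * h n t) = \<gamma> t * (\<Sum>n. h n t)" if "t \<in> {a..b}" for t
    using h(2)[OF that] by (intro suminf_mult summable_comparison_test'[OF \<open>summable M\<close>]) auto
  then have "uniform_limit {a..b} (\<lambda>n t. \<Sum>i<n. \<gamma> t * h i t) (\<lambda>t. \<Sum>n. \<gamma> t * h n t) sequentially \<longleftrightarrow>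
      uniform_limit {a..b} (\<lambda>n t. \<Sum>i<n. \<gamma> t * h i t) (\<lambda>t. \<gamma> t * (\<Sum>n. h n t)) sequentially"
    by (intro uniform_limit_cong') simp_all
  ultimately show "uniform_limit {a..b} (\<lambda>n t. \<Sum>i<n. \<gamma> t * h i t) (\<lambda>t. \<gamma> t * (\<Sum>n. h n t)) sequentially"
    by blast
  show "a \<in> {a..b}" using \<open>a \<le> b\<close> by simp
qed auto

lemma linear_system_exists:
  assumes "a < b" and c: "continuous_on {a..b} \<alpha>" "continuous_on {a..b} \<beta>"
  shows "\<exists>u v. (\<forall>t\<in>{a..b}. (u has_real_derivative \<alpha> t * v t) (at t within {a..b}) \<and>
                            (v has_real_derivative \<beta> t * u t) (at t within {a..b})) \<and>
               u a = 1 \<and> v a = 0"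
proof -
  obtain K1 where K1: "K1 \<ge> 0" "\<And>t. t \<in> {a..b} \<Longrightarrow> norm (\<alpha> t) \<le> K1"
    using continuous_on_compact_bound[OF compact_Icc c(1)] by blast
  obtain K2 where K2: "K2 \<ge> 0" "\<And>t. t \<in> {a..b} \<Longrightarrow> norm (\<beta> t) \<le> K2"
    using continuous_on_compact_bound[OF compact_Icc c(2)] by blast
  define K where "K = max K1 K2"
  have K: "\<bar>\<alpha> t\<bar> \<le> K" "\<bar>\<beta> t\<bar> \<le> K" if "t \<in> {a..b}" for t
    using K1(2)[OF that] K2(2)[OF that] by (simp_all add: K_def)
  have "0 \<le> K" using K1(1) by (simp add: K_def)
  note K = K this
  define f where "f n = fst (picard a \<alpha> \<beta> n)" for n
  define g where "g n = snd (picard a \<alpha> \<beta> n)" for n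
  define M where "M n = (K * (b - a)) ^ n / fact n" for n
  have cont: "continuous_on {a..b} (f n)" "continuous_on {a..b} (g n)" for n
    using picard_bound[OF c K] by (auto simp: f_def g_def)
  have le: "\<bar>f n t\<bar> \<le> M n" "\<bar>g n t\<bar> \<le> M n" if "t \<in> {a..b}" for n t
  proof -
    have "(K * (t - a)) ^ n / fact n \<le> M n"
      unfolding M_def using that K(3) by (intro divide_right_mono power_mono mult_left_mono) auto
    then show "\<bar>f n t\<bar> \<le> M n" "\<bar>g n t\<bar> \<le> M n"
      using picard_bound[OF c K, of n] that by (auto simp: f_def g_def intro: order_trans)
  qed
  have M: "summable M"
    unfolding M_def using summable_exp[of "K * (b - a)"] by (simp add: field_simps)
  have sumf: "summable (\<lambda>n. f n t)" and sumg: "summable (\<lambda>n. g n t)" if "t \<in> {a..b}" for t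
    using le[OF that] by (auto intro!: summable_comparison_test'[OF M])
  obtain U where U: "\<And>t. t \<in> {a..b} \<Longrightarrow> (\<lambda>n. f (Suc n) t) sums U t"
      "\<And>t. t \<in> {a..b} \<Longrightarrow> (U has_real_derivative \<alpha> t * (\<Sum>n. g n t)) (at t within {a..b})"
    using series_of_primitives[OF less_imp_le[OF \<open>a < b\<close>] c(1) cont(2) le(2) M]
    unfolding f_def g_def picard.simps fst_conv by blast
  obtain V where V: "\<And>t. t \<in> {a..b} \<Longrightarrow> (\<lambda>n. g (Suc n) t) sums V t"
      "\<And>t. t \<in> {a..b} \<Longrightarrow> (V has_real_derivative \<beta> t * (\<Sum>n. f n t)) (at t within {a..b})"
    using series_of_primitives[OF less_imp_le[OF \<open>a < b\<close>] c(2) cont(1) le(1) M]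
    unfolding f_def g_def picard.simps snd_conv by blast
  \<comment> \<open>The first series splits off its starting term 1; in the second the starting term
    is 0, so \<open>V\<close> is already the whole sum.\<close>
  have f: "(\<Sum>n. f n t) = 1 + U t" if "t \<in> {a..b}" for t
    using suminf_split_head[OF sumf[OF that]] U(1)[OF that] by (simp add: sums_iff f_def)
  have g: "(\<Sum>n. g n t) = V t" if "t \<in> {a..b}" for t
    using suminf_split_head[OF sumg[OF that]] V(1)[OF that] by (simp add: sums_iff g_def)
  have "a \<in> {a..b}" using \<open>a < b\<close> by simp
  from U(1)[OF this] V(1)[OF this] have "U a = 0" "V a = 0"
    by (simp_all add: f_def g_def sums_iff)
  moreover have "((\<lambda>t. 1 + U t) has_real_derivative \<alpha> t * V t) (at t within {a..b})"
    "(V has_real_derivative \<beta> t * (1 + U t)) (at t within {a..b})" if "t \<in> {a..b}" for t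
    using U(2)[OF that] V(2)[OF that] f[OF that] g[OF that] by (auto intro!: derivative_eq_intros)
  ultimately show ?thesis by (intro exI[of _ "\<lambda>t. 1 + U t"] exI[of _ V]) auto
qed

lemma lin_sol_exists_left:
  assumes "a < b" "continuous_on {a..b} \<alpha>" "continuous_on {a..b} \<beta>"
  shows "\<exists>u v. lin_sol a b \<alpha> \<beta> u v \<and> u a = 1 \<and> v a = 0"
proof -
  obtain u v where uv: "\<And>t. t \<in> {a..b} \<Longrightarrow> (u has_real_derivative \<alpha> t * v t) (at t within {a..b})"
      "\<And>t. t \<in> {a..b} \<Longrightarrow> (v has_real_derivative \<beta> t * u t) (at t within {a..b})"
      "u a = 1" "v a = 0"
    using linear_system_exists[OF assms] by blast
  have "lin_sol a b \<alpha> \<beta> u v"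
    unfolding lin_sol_def
  proof (intro conjI ballI)
    show "continuous_on {a..b} v"
      using uv(2) DERIV_continuous continuous_on_eq_continuous_within by blast
    show "(v has_real_derivative \<beta> t * u t) (at t)" if "t \<in> {a<..<b}" for t
      using that DERIV_within_Icc_imp_at[OF uv(2)] by simp
  qed (use uv in auto)
  with uv show ?thesis by blast
qed

text \<open>Reflection about the midpoint exchanges the two ends; reversing the direction flips the
  sign of both coefficients.\<close>

lemma lin_sol_exists_right:
  assumes "a < b" and c: "continuous_on {a..b} \<alpha>" "continuous_on {a..b} \<beta>"
  shows "\<exists>u v. lin_sol a b \<alpha> \<beta> u v \<and> u b = 1 \<and> v b = 0"
proof -
  define r where "r t = a + b - t" for t
  have r: "r ` {a..b} \<subseteq> {a..b}" "continuous_on {a..b} r" unfolding r_def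
    by (auto intro!: continuous_intros)
  have "continuous_on {a..b} (\<lambda>t. - \<alpha> (r t))" "continuous_on {a..b} (\<lambda>t. - \<beta> (r t))"
    using c r by (auto intro!: continuous_on_minus intro: continuous_on_compose2)
  from lin_sol_exists_left[OF \<open>a < b\<close> this] obtain u v
    where uv: "lin_sol a b (\<lambda>t. - \<alpha> (r t)) (\<lambda>t. - \<beta> (r t)) u v" "u a = 1" "v a = 0" by blast
  have "lin_sol a b \<alpha> \<beta> (\<lambda>t. u (r t)) (\<lambda>t. v (r t))"
    unfolding lin_sol_def
  proof (intro conjI ballI)
    fix t assume t: "t \<in> {a..b}"
    have "((u \<circ> r) has_real_derivative (- \<alpha> (r (r t)) * v (r t)) * (-1)) (at t within {a..b})"
    proof (rule DERIV_image_chain)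
      have "(u has_real_derivative - \<alpha> (r (r t)) * v (r t)) (at (r t) within {a..b})"
        using lin_solD(5)[OF uv(1)] t r(1) by blast
      then show "(u has_real_derivative - \<alpha> (r (r t)) * v (r t)) (at (r t) within r ` {a..b})"
        using DERIV_subset r(1) by blast
    qed (auto simp: r_def[abs_def] intro!: derivative_eq_intros)
    then show "((\<lambda>t. u (r t)) has_real_derivative \<alpha> t * v (r t)) (at t within {a..b})"
      by (simp add: o_def r_def)
  next
    show "continuous_on {a..b} (\<lambda>t. v (r t))"
      using continuous_on_compose2[OF lin_solD(2)[OF uv(1)] r(2,1)] .
  next
    fix t assume t: "t \<in> {a<..<b}"
    then have "r t \<in> {a<..<b}" by (auto simp: r_def)
    then have "(v has_real_derivative - \<beta> (r (r t)) * u (r t)) (at (r t))"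
      using lin_solD(4)[OF uv(1)] by blast
    moreover have "(r has_real_derivative -1) (at t)"
      unfolding r_def[abs_def] by (auto intro!: derivative_eq_intros)
    ultimately have "((\<lambda>t. v (r t)) has_real_derivative (- \<beta> (r (r t)) * u (r t)) * (-1)) (at t)"
      by (rule DERIV_chain2)
    then show "((\<lambda>t. v (r t)) has_real_derivative \<beta> t * u (r t)) (at t)"
      by (simp add: r_def)
  qed
  moreover have "u (r b) = 1" "v (r b) = 0" using uv by (simp_all add: r_def)
  ultimately show ?thesis by blast
qed

subsection \<open>Gronwall estimates\<close>

text \<open>Because the bound is on the absolute value of the derivative, \<open>F\<close> times
  \<open>exp (- K t)\<close> decreases and \<open>F\<close> times \<open>exp (K t)\<close>
  increases, so the estimate runs both ways in time. Shooting from the right end uses the backward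
  direction.\<close>

lemma gronwall:
  fixes F :: "real \<Rightarrow> real"
  assumes F: "continuous_on {a..b} F"
    and F': "\<And>t. t \<in> {a<..<b} \<Longrightarrow> \<exists>D. (F has_real_derivative D) (at t) \<and> \<bar>D\<bar> \<le> K * F t"
    and st: "s \<in> {a..b}" "t \<in> {a..b}"
  shows "F t \<le> F s * exp (K * \<bar>t - s\<bar>)"
proof (cases "s \<le> t")
  case True
  have "F t * exp (- K * (t - s)) \<le> F s * exp (- K * (s - s))"
  proof (rule DERIV_nonpos_imp_decreasing_open[OF True])
    fix x assume "s < x" "x < t"
    then have "x \<in> {a<..<b}" using st by auto
    then obtain D where D: "(F has_real_derivative D) (at x)" "\<bar>D\<bar> \<le> K * F x" using F' by blast
    have "((\<lambda>x. F x * exp (- K * (x - s))) has_real_derivative (D - K * F x) * exp (- K * (x - s))) (at x)"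
      by (rule derivative_eq_intros D(1) refl | simp add: algebra_simps)+
    moreover have "(D - K * F x) * exp (- K * (x - s)) \<le> 0"
      using D(2) by (intro mult_nonpos_nonneg) auto
    ultimately show "\<exists>y. ((\<lambda>x. F x * exp (- K * (x - s))) has_real_derivative y) (at x) \<and> y \<le> 0" by blast
  next
    show "continuous_on {s..t} (\<lambda>x. F x * exp (- K * (x - s)))"
      using st by (auto intro!: continuous_intros continuous_on_subset[OF F])
  qed
  then have "F t * exp (- K * (t - s)) * exp (K * (t - s)) \<le> F s * exp (K * (t - s))"
    by simp
  with True show ?thesis by (simp add: mult.assoc flip: exp_add)
next
  case False
  then have le: "t \<le> s" by simp
  have "F t * exp (K * (t - s)) \<le> F s * exp (K * (s - s))"
  proof (rule DERIV_nonneg_imp_increasing_open[OF le])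
    fix x assume "t < x" "x < s"
    then have "x \<in> {a<..<b}" using st by auto
    then obtain D where D: "(F has_real_derivative D) (at x)" "\<bar>D\<bar> \<le> K * F x" using F' by blast
    have "((\<lambda>x. F x * exp (K * (x - s))) has_real_derivative (D + K * F x) * exp (K * (x - s))) (at x)"
      by (rule derivative_eq_intros D(1) refl | simp add: algebra_simps)+
    moreover have "(D + K * F x) * exp (K * (x - s)) \<ge> 0"
      using D(2) by (intro mult_nonneg_nonneg) auto
    ultimately show "\<exists>y. ((\<lambda>x. F x * exp (K * (x - s))) has_real_derivative y) (at x) \<and> y \<ge> 0" by blast
  next
    show "continuous_on {t..s} (\<lambda>x. F x * exp (K * (x - s)))"
      using st by (auto intro!: continuous_intros continuous_on_subset[OF F])
  qed
  then have "F t * exp (K * (t - s)) * exp (K * (s - t)) \<le> F s * exp (K * (s - t))"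
    by simp
  moreover have "K * (t - s) + K * (s - t) = 0" by (simp add: algebra_simps)
  ultimately show ?thesis using False by (simp add: mult.assoc flip: exp_add)
qed

text \<open>The energy \<open>F\<close> contains \<open>B\<^sup>2\<close> so that the forcing term
  \<open>2 v h\<close> is at most \<open>F\<close>; the cross term is at most \<open>2 K F\<close>,
  hence the rate \<open>2 K + 1\<close>. With \<open>B = 0\<close> this is uniqueness, with
  \<open>h\<close> proportional to a parameter difference it is Lipschitz dependence.\<close>

lemma perturbed_system_bound:
  assumes cont: "continuous_on {a..b} u" "continuous_on {a..b} v"
    and u': "\<And>t. t \<in> {a<..<b} \<Longrightarrow> (u has_real_derivative \<alpha> t * v t) (at t)"
    and v': "\<And>t. t \<in> {a<..<b} \<Longrightarrow> (v has_real_derivative \<beta> t * u t + h t) (at t)"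
    and K: "\<And>t. t \<in> {a<..<b} \<Longrightarrow> \<bar>\<alpha> t\<bar> \<le> K" "\<And>t. t \<in> {a<..<b} \<Longrightarrow> \<bar>\<beta> t\<bar> \<le> K"
    and h: "\<And>t. t \<in> {a<..<b} \<Longrightarrow> \<bar>h t\<bar> \<le> B"
    and st: "s \<in> {a..b}" "u s = 0" "v s = 0" "t \<in> {a..b}"
  shows "(u t)\<^sup>2 + (v t)\<^sup>2 \<le> B\<^sup>2 * exp ((2 * K + 1) * (b - a))"
proof -
  define F where "F t = (u t)\<^sup>2 + (v t)\<^sup>2 + B\<^sup>2" for t
  show ?thesis
  proof (cases "{a<..<b} = {}")
    case True
    then have "s = t" using st by auto
    then show ?thesis using st by simp
  next
    case False
    then obtain x where "x \<in> {a<..<b}" by blast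
    then have K0: "0 \<le> K" using K(1)[of x] by auto
    have "F t \<le> F s * exp ((2 * K + 1) * \<bar>t - s\<bar>)"
    proof (rule gronwall[OF _ _ st(1,4)])
      show "continuous_on {a..b} F" unfolding F_def by (intro continuous_intros cont)
      fix x assume x: "x \<in> {a<..<b}"
      let ?D = "2 * (\<alpha> x + \<beta> x) * (u x * v x) + 2 * (v x * h x)"
      have "(F has_real_derivative ?D) (at x)"
        unfolding F_def by (rule derivative_eq_intros u'[OF x] v'[OF x] refl | simp add: algebra_simps)+
      moreover have "\<bar>?D\<bar> \<le> (2 * K + 1) * F x"
      proof -
        have uv: "2 * \<bar>u x * v x\<bar> \<le> (u x)\<^sup>2 + (v x)\<^sup>2"
          using sum_squares_bound[of "\<bar>u x\<bar>" "\<bar>v x\<bar>"] by (simp add: abs_mult)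
        have "2 * (\<bar>v x\<bar> * \<bar>h x\<bar>) \<le> (v x)\<^sup>2 + (h x)\<^sup>2"
          using sum_squares_bound[of "\<bar>v x\<bar>" "\<bar>h x\<bar>"] by simp
        moreover have "(h x)\<^sup>2 \<le> B\<^sup>2" using h[OF x] power_mono[of "\<bar>h x\<bar>" B 2] by simp
        ultimately have vh: "\<bar>2 * (v x * h x)\<bar> \<le> F x"
          using zero_le_power2[of "u x"] unfolding F_def abs_mult abs_numeral by linarith
        have "\<bar>2 * (\<alpha> x + \<beta> x) * (u x * v x)\<bar> = \<bar>\<alpha> x + \<beta> x\<bar> * (2 * \<bar>u x * v x\<bar>)"
          unfolding abs_mult by simp
        also have "\<dots> \<le> (2 * K) * F x"
          using uv K[OF x] K0 by (intro mult_mono) (auto simp: F_def intro: order_trans)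
        finally have "\<bar>2 * (\<alpha> x + \<beta> x) * (u x * v x)\<bar> \<le> (2 * K) * F x" .
        with vh show ?thesis by (simp add: algebra_simps)
      qed
      ultimately show "\<exists>D. (F has_real_derivative D) (at x) \<and> \<bar>D\<bar> \<le> (2 * K + 1) * F x" by blast
    qed
    also have "\<dots> = B\<^sup>2 * exp ((2 * K + 1) * \<bar>t - s\<bar>)" using st by (simp add: F_def)
    also have "\<dots> \<le> B\<^sup>2 * exp ((2 * K + 1) * (b - a))"
      using st K0 by (intro mult_left_mono exp_le_cancel_iff[THEN iffD2]) auto
    finally show ?thesis using zero_le_power2[of B] unfolding F_def by linarith
  qed
qed

lemma lin_sol_zero:
  assumes uv: "lin_sol a b \<alpha> \<beta> u v"
    and K: "\<And>t. t \<in> {a..b} \<Longrightarrow> \<bar>\<alpha> t\<bar> \<le> K" "\<And>t. t \<in> {a..b} \<Longrightarrow> \<bar>\<beta> t\<bar> \<le> K"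
    and st: "s \<in> {a..b}" "u s = 0" "v s = 0" "t \<in> {a..b}"
  shows "u t = 0"
proof -
  have "(u t)\<^sup>2 + (v t)\<^sup>2 \<le> 0\<^sup>2 * exp ((2 * K + 1) * (b - a))"
    using lin_solD[OF uv] K st
    by (intro perturbed_system_bound[where h = "\<lambda>_. 0" and s = s and \<alpha> = \<alpha> and \<beta> = \<beta>]) auto
  then show ?thesis by (simp add: sum_power2_le_zero_iff)
qed


subsection \<open>Comparison and subcritical parameters\<close>

text \<open>With equal coefficients the Wronskian \<open>y v - u w\<close> is constant. Vanishing at
  \<open>e\<close>, it is zero throughout, so \<open>u / y\<close> is constant, and the zero of
  \<open>u\<close> at \<open>s\<close> makes that constant 0.\<close>

lemma lin_sol_proportional:
  assumes uv: "lin_sol c d \<alpha> \<beta> u v" and yw: "lin_sol c d \<alpha> \<beta> y w" and "c < d"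
    and y: "\<And>t. t \<in> {c..d} \<Longrightarrow> 0 < y t"
    and e: "e \<in> {c..d}" "y e * v e = u e * w e"
    and s: "s \<in> {c..d}" "u s = 0" and t: "t \<in> {c..d}"
  shows "u t = 0"
proof -
  note u = lin_solD[OF uv] and w = lin_solD[OF yw]
  have W': "((\<lambda>x. y x * v x - u x * w x) has_real_derivative 0) (at x)" if "c < x" "x < d" for x
    using that by (auto intro!: derivative_eq_intros u(3,4) w(3,4) simp: algebra_simps)
  have Wc: "y x * v x - u x * w x = y c * v c - u c * w c" if "x \<in> {c..d}" for x
    using that \<open>c < d\<close> W' u(1,2) w(1,2)
    by (intro DERIV_isconst2[of c d "\<lambda>x. y x * v x - u x * w x"] continuous_intros) auto
  have W: "y x * v x - u x * w x = 0" if "x \<in> {c..d}" for x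
    using Wc[OF that] Wc[OF e(1)] e(2) by simp
  have "((\<lambda>x. u x / y x) has_real_derivative 0) (at x)" if "c < x" "x < d" for x
  proof -
    have "((\<lambda>x. u x / y x) has_real_derivative
        (\<alpha> x * v x * y x - u x * (\<alpha> x * w x)) / (y x * y x)) (at x)"
      using that y[of x] by (intro DERIV_divide u(3) w(3)) auto
    moreover have "\<alpha> x * v x * y x - u x * (\<alpha> x * w x) = \<alpha> x * (y x * v x - u x * w x)"
      by (simp add: algebra_simps)
    ultimately show ?thesis using W[of x] that by simp
  qed
  then have "u x / y x = u c / y c" if "x \<in> {c..d}" for x
    using that \<open>c < d\<close> u(1) w(1) y
    by (intro DERIV_isconst2[of c d "\<lambda>x. u x / y x"] continuous_intros) force+
  from this[OF s(1)] this[OF t] s(2) y[OF t] y[of c] \<open>c < d\<close> show ?thesis by simp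
qed

text \<open>\<open>c\<close> is the left end of the component of positivity containing
  \<open>x\<close>: the maximum of the compact set where \<open>f <= 0\<close>, or \<open>a\<close>
  if that set is empty.\<close>

lemma last_nonpositive_point:
  fixes f :: "real \<Rightarrow> real"
  assumes f: "continuous_on {a..x} f" and "a \<le> x" "0 < f x"
  obtains c where "c \<in> {a..x}" "\<And>t. t \<in> {c<..x} \<Longrightarrow> 0 < f t" "f c = 0 \<or> c = a"
proof (cases "\<forall>t\<in>{a..x}. 0 < f t")
  case True
  then show ?thesis using that[of a] assms by auto
next
  case False
  define Z where "Z = {t \<in> {a..x}. f t \<le> 0}"
  have "closed Z" unfolding Z_def using f by (intro continuous_on_closed_Collect_le) auto
  moreover have "bounded Z" unfolding Z_def by (rule bounded_subset[of "{a..x}"]) auto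
  ultimately have "compact Z" by (simp add: compact_eq_bounded_closed)
  moreover have "Z \<noteq> {}" using False by (auto simp: Z_def not_less)
  ultimately obtain c where c: "c \<in> Z" "\<And>t. t \<in> Z \<Longrightarrow> t \<le> c"
    using continuous_attains_sup[of Z "\<lambda>t. t"] by auto
  have pos: "0 < f t" if "t \<in> {c<..x}" for t
    using c(2)[of t] c(1) that by (force simp: Z_def)
  have "continuous_on {c..x} f" using c(1) by (intro continuous_on_subset[OF f]) (auto simp: Z_def)
  then obtain e where e: "c \<le> e" "e \<le> x" "f e = 0"
    using IVT'[of f c 0 x] c(1) assms(3) by (auto simp: Z_def)
  then have "e = c" using pos[of e] by force
  with e pos c(1) show ?thesis using that[of c] by (auto simp: Z_def)
qed

lemma first_nonpositive_point:
  fixes f :: "real \<Rightarrow> real"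
  assumes f: "continuous_on {x..b} f" and "x \<le> b" "0 < f x"
  obtains d where "d \<in> {x..b}" "\<And>t. t \<in> {x..<d} \<Longrightarrow> 0 < f t" "f d = 0 \<or> d = b"
proof -
  have "continuous_on {-b..-x} (\<lambda>t. f (- t))"
    by (rule continuous_on_compose2[OF f]) (auto intro!: continuous_intros)
  then obtain c where c: "c \<in> {-b..-x}" "\<And>t. t \<in> {c<..-x} \<Longrightarrow> 0 < f (- t)" "f (- c) = 0 \<or> c = -b"
    using last_nonpositive_point[of "-b" "-x" "\<lambda>t. f (- t)"] assms by auto
  show ?thesis
    using that[of "-c"] c(1,3) c(2)[of "- t" for t] by force
qed

section \<open>The Neumann setting: reformulation, existence, dependence on the parameter\<close>

locale neumann_data =
  fixes T1 T2 :: real and p q m :: "real \<Rightarrow> real"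
  assumes T: "T1 < T2"
    and p: "continuous_on {T1..T2} p" and q: "continuous_on {T1..T2} q"
    and m: "continuous_on {T1..T2} m"
    and p_pos: "\<And>t. t \<in> {T1..T2} \<Longrightarrow> 0 < p t" and q_nonneg: "\<And>t. t \<in> {T1..T2} \<Longrightarrow> 0 \<le> q t"
begin

abbreviation sol :: "real \<Rightarrow> (real \<Rightarrow> real) \<Rightarrow> (real \<Rightarrow> real) \<Rightarrow> bool" where
  "sol \<kappa> \<equiv> lin_sol T1 T2 (\<lambda>t. 1 / p t) (\<lambda>t. q t - \<kappa> * m t)"

lemma continuous_inverse_p: "continuous_on {T1..T2} (\<lambda>t. 1 / p t)"
  using p p_pos by (intro continuous_intros) force+

lemma bounds:
  obtains P Q M where "0 \<le> P" "0 \<le> Q" "0 \<le> M"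
    "\<And>t. t \<in> {T1..T2} \<Longrightarrow> \<bar>1 / p t\<bar> \<le> P" "\<And>t. t \<in> {T1..T2} \<Longrightarrow> \<bar>q t\<bar> \<le> Q"
    "\<And>t. t \<in> {T1..T2} \<Longrightarrow> \<bar>m t\<bar> \<le> M"
  using continuous_on_compact_bound[OF compact_Icc continuous_inverse_p]
    continuous_on_compact_bound[OF compact_Icc q] continuous_on_compact_bound[OF compact_Icc m]
  unfolding real_norm_def by metis

text \<open>The weight \<open>\<gamma>\<close> is an arbitrary function so that one statement covers
  eigenfunctions as well as solutions of (P), whose weight depends on the sign of
  \<open>u\<close>.\<close>

lemma neumann_solution_iff:
  "neumann_solution T1 T2 p q (\<lambda>t. \<gamma> t * u t) u \<longleftrightarrow>
   (\<exists>v. lin_sol T1 T2 (\<lambda>t. 1 / p t) (\<lambda>t. q t - \<gamma> t) u v \<and> v T1 = 0 \<and> v T2 = 0)"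
proof
  assume "neumann_solution T1 T2 p q (\<lambda>t. \<gamma> t * u t) u"
  then obtain u' where u':
    "\<And>t. t \<in> {T1..T2} \<Longrightarrow> (u has_real_derivative u' t) (at t within {T1..T2})"
    "continuous_on {T1..T2} u'"
    "\<And>t. t \<in> {T1<..<T2} \<Longrightarrow> \<exists>D. ((\<lambda>s. p s * u' s) has_real_derivative D) (at t) \<and>
                              - D + q t * u t = \<gamma> t * u t"
    "u' T1 = 0" "u' T2 = 0"
    unfolding neumann_solution_def by blast
  have "lin_sol T1 T2 (\<lambda>t. 1 / p t) (\<lambda>t. q t - \<gamma> t) u (\<lambda>s. p s * u' s)"
    unfolding lin_sol_def
  proof (intro conjI ballI)
    show "continuous_on {T1..T2} (\<lambda>s. p s * u' s)" using p u'(2) by (intro continuous_intros)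
    show "(u has_real_derivative 1 / p t * (p t * u' t)) (at t within {T1..T2})"
      if "t \<in> {T1..T2}" for t using u'(1)[OF that] p_pos[OF that] by simp
    show "((\<lambda>s. p s * u' s) has_real_derivative (q t - \<gamma> t) * u t) (at t)"
      if t: "t \<in> {T1<..<T2}" for t
    proof -
      obtain D where D: "((\<lambda>s. p s * u' s) has_real_derivative D) (at t)" "- D + q t * u t = \<gamma> t * u t"
        using u'(3)[OF t] by blast
      then have "D = (q t - \<gamma> t) * u t" by (simp add: algebra_simps)
      with D show ?thesis by simp
    qed
  qed
  with u' show "\<exists>v. lin_sol T1 T2 (\<lambda>t. 1 / p t) (\<lambda>t. q t - \<gamma> t) u v \<and> v T1 = 0 \<and> v T2 = 0"
    by (intro exI[of _ "\<lambda>s. p s * u' s"]) simp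
next
  assume "\<exists>v. lin_sol T1 T2 (\<lambda>t. 1 / p t) (\<lambda>t. q t - \<gamma> t) u v \<and> v T1 = 0 \<and> v T2 = 0"
  then obtain v where v: "lin_sol T1 T2 (\<lambda>t. 1 / p t) (\<lambda>t. q t - \<gamma> t) u v" "v T1 = 0" "v T2 = 0"
    by blast
  show "neumann_solution T1 T2 p q (\<lambda>t. \<gamma> t * u t) u"
    unfolding neumann_solution_def
  proof (intro exI[of _ "\<lambda>t. 1 / p t * v t"] conjI ballI)
    show "continuous_on {T1..T2} (\<lambda>t. 1 / p t * v t)"
      by (intro continuous_on_mult continuous_inverse_p lin_solD(2)[OF v(1)])
    fix t assume t: "t \<in> {T1<..<T2}"
    \<comment> \<open>The factor \<open>p\<close> cancels only where it is known to be nonzero, that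
      is on the interval; hence the local transfer of the derivative.\<close>
    have "((\<lambda>s. p s * (1 / p s * v s)) has_real_derivative (q t - \<gamma> t) * u t) (at t)"
    proof (rule has_field_derivative_transform_within_open[OF lin_solD(4)[OF v(1) t] _ t])
      show "v s = p s * (1 / p s * v s)" if "s \<in> {T1<..<T2}" for s
        using p_pos[of s] that by simp
    qed simp
    then show "\<exists>D. ((\<lambda>s. p s * (1 / p s * v s)) has_real_derivative D) (at t) \<and> - D + q t * u t = \<gamma> t * u t"
      by (intro exI[of _ "(q t - \<gamma> t) * u t"]) (simp add: algebra_simps)
  qed (use v lin_solD(5)[OF v(1)] in auto)
qed

lemma sol_exists:
  assumes "s \<in> {T1, T2}"
  obtains u v where "sol \<kappa> u v" "u s = 1" "v s = 0"
proof -
  have "continuous_on {T1..T2} (\<lambda>t. q t - \<kappa> * m t)" using q m by (intro continuous_intros)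
  from lin_sol_exists_left[OF T continuous_inverse_p this] lin_sol_exists_right[OF T continuous_inverse_p this]
  show ?thesis using that assms by blast
qed

text \<open>The difference of the two solutions vanishes at \<open>s\<close> and solves the
  \<open>\<kappa>\<close> system with forcing \<open>- (\<kappa> - \<mu>) m u0\<close>. Staying
  within distance 1 of \<open>\<mu>\<close> bounds the coefficients uniformly, so \<open>C\<close>
  does not depend on \<open>\<kappa>\<close>.\<close>

lemma sol_dependence:
  assumes uv0: "sol \<mu> u0 v0" and s: "s \<in> {T1..T2}"
  obtains C where "0 < C"
    "\<And>\<kappa> u v t. \<lbrakk>\<bar>\<kappa> - \<mu>\<bar> \<le> 1; sol \<kappa> u v; u s = u0 s; v s = v0 s; t \<in> {T1..T2}\<rbrakk>
       \<Longrightarrow> \<bar>u t - u0 t\<bar> \<le> C * \<bar>\<kappa> - \<mu>\<bar> \<and> \<bar>v t - v0 t\<bar> \<le> C * \<bar>\<kappa> - \<mu>\<bar>"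
proof -
  obtain P Q M where PQM: "0 \<le> P" "0 \<le> Q" "0 \<le> M"
    "\<And>t. t \<in> {T1..T2} \<Longrightarrow> \<bar>1 / p t\<bar> \<le> P" "\<And>t. t \<in> {T1..T2} \<Longrightarrow> \<bar>q t\<bar> \<le> Q"
    "\<And>t. t \<in> {T1..T2} \<Longrightarrow> \<bar>m t\<bar> \<le> M" using bounds by blast
  obtain N where N: "0 \<le> N" "\<And>t. t \<in> {T1..T2} \<Longrightarrow> norm (u0 t) \<le> N"
    using continuous_on_compact_bound[OF compact_Icc lin_solD(1)[OF uv0]] by blast
  define K where "K = P + Q + (\<bar>\<mu>\<bar> + 1) * M"
  \<comment> \<open>Half the exponent of the energy estimate, which controls squares; the square
    root is taken at the end.\<close>
  define E where "E = exp ((2 * K + 1) * (T2 - T1) / 2)"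
  have E2: "exp ((2 * K + 1) * (T2 - T1)) = E\<^sup>2"
    by (simp add: E_def power2_eq_square flip: exp_add)
  show ?thesis
  proof (rule that[of "M * N * E + 1"])
    show "0 < M * N * E + 1" using PQM N by (simp add: E_def add_nonneg_pos)
  next
    fix \<kappa> u v t
    assume l: "\<bar>\<kappa> - \<mu>\<bar> \<le> 1" and uv: "sol \<kappa> u v" and eq: "u s = u0 s" "v s = v0 s" and t: "t \<in> {T1..T2}"
    note d = lin_solD[OF uv] lin_solD[OF uv0]
    have "(u t - u0 t)\<^sup>2 + (v t - v0 t)\<^sup>2 \<le> (\<bar>\<kappa> - \<mu>\<bar> * (M * N))\<^sup>2 * exp ((2 * K + 1) * (T2 - T1))"
    proof (rule perturbed_system_bound[where u = "\<lambda>t. u t - u0 t" and v = "\<lambda>t. v t - v0 t" and \<alpha> = "\<lambda>t. 1 / p t" and \<beta> = "\<lambda>t. q t - \<kappa> * m t"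
          and h = "\<lambda>t. - ((\<kappa> - \<mu>) * (m t * u0 t))" and s = s])
      show "continuous_on {T1..T2} (\<lambda>t. u t - u0 t)" "continuous_on {T1..T2} (\<lambda>t. v t - v0 t)"
        by (intro continuous_intros d)+
      fix x assume x: "x \<in> {T1<..<T2}"
      then have x': "x \<in> {T1..T2}" by simp
      show "((\<lambda>t. u t - u0 t) has_real_derivative 1 / p x * (v x - v0 x)) (at x)"
        by (rule derivative_eq_intros d(3,8)[OF x] refl | simp add: algebra_simps diff_divide_distrib)+
      show "((\<lambda>t. v t - v0 t) has_real_derivative
          (q x - \<kappa> * m x) * (u x - u0 x) + - ((\<kappa> - \<mu>) * (m x * u0 x))) (at x)"
        by (rule derivative_eq_intros d(4,9)[OF x] refl | simp add: algebra_simps)+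
      show "\<bar>1 / p x\<bar> \<le> K" using PQM(4)[OF x'] PQM by (simp add: K_def add_increasing2)
      have "\<bar>\<kappa> * m x\<bar> \<le> (\<bar>\<mu>\<bar> + 1) * M"
        unfolding abs_mult using l PQM(6)[OF x'] by (intro mult_mono) auto
      then show "\<bar>q x - \<kappa> * m x\<bar> \<le> K"
        using PQM(1) PQM(5)[OF x'] unfolding K_def by linarith
      show "\<bar>- ((\<kappa> - \<mu>) * (m x * u0 x))\<bar> \<le> \<bar>\<kappa> - \<mu>\<bar> * (M * N)"
        unfolding abs_mult abs_minus_cancel using N(2)[OF x'] PQM(3) PQM(6)[OF x']
        by (intro mult_left_mono mult_mono) auto
    qed (use s t eq in auto)
    also have "\<dots> = (\<bar>\<kappa> - \<mu>\<bar> * (M * N * E))\<^sup>2"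
      unfolding E2 by (simp add: power_mult_distrib mult_ac)
    finally have le: "(u t - u0 t)\<^sup>2 + (v t - v0 t)\<^sup>2 \<le> (\<bar>\<kappa> - \<mu>\<bar> * (M * N * E))\<^sup>2" .
    have nn: "0 \<le> \<bar>\<kappa> - \<mu>\<bar> * (M * N * E)" using PQM N by (simp add: E_def)
    have "\<bar>u t - u0 t\<bar> \<le> \<bar>\<kappa> - \<mu>\<bar> * (M * N * E)" "\<bar>v t - v0 t\<bar> \<le> \<bar>\<kappa> - \<mu>\<bar> * (M * N * E)"
      using power2_le_imp_le[OF _ nn, of "\<bar>u t - u0 t\<bar>"] power2_le_imp_le[OF _ nn, of "\<bar>v t - v0 t\<bar>"]
        le zero_le_power2[of "u t - u0 t"] zero_le_power2[of "v t - v0 t"]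
      unfolding power2_abs by linarith+
    then show "\<bar>u t - u0 t\<bar> \<le> (M * N * E + 1) * \<bar>\<kappa> - \<mu>\<bar> \<and> \<bar>v t - v0 t\<bar> \<le> (M * N * E + 1) * \<bar>\<kappa> - \<mu>\<bar>"
      by (simp add: algebra_simps add_increasing)
  qed
qed

text \<open>Uniqueness for the weight \<open>m \<eta>\<close> with \<open>\<eta>\<close> merely
  bounded, the form in which the jumping weight of (P) can be treated.\<close>

lemma sol_zero:
  assumes uv: "lin_sol T1 T2 (\<lambda>t. 1 / p t) (\<lambda>t. q t - m t * \<eta> t) u v"
    and \<eta>: "\<And>t. \<bar>\<eta> t\<bar> \<le> H"
    and st: "s \<in> {T1..T2}" "u s = 0" "v s = 0" "t \<in> {T1..T2}"
  shows "u t = 0"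
proof -
  obtain P Q M where PQM: "0 \<le> P" "0 \<le> Q" "0 \<le> M"
    "\<And>t. t \<in> {T1..T2} \<Longrightarrow> \<bar>1 / p t\<bar> \<le> P" "\<And>t. t \<in> {T1..T2} \<Longrightarrow> \<bar>q t\<bar> \<le> Q"
    "\<And>t. t \<in> {T1..T2} \<Longrightarrow> \<bar>m t\<bar> \<le> M" using bounds by blast
  have H: "0 \<le> H" using \<eta>[of 0] by linarith
  show ?thesis
  proof (rule lin_sol_zero[OF uv _ _ st, where K = "P + Q + M * H"])
    fix x assume x: "x \<in> {T1..T2}"
    show "\<bar>1 / p x\<bar> \<le> P + Q + M * H" using PQM(4)[OF x] PQM H by (simp add: add_increasing2)
    have "\<bar>m x * \<eta> x\<bar> \<le> M * H"
      unfolding abs_mult using PQM(3) PQM(6)[OF x] \<eta> by (intro mult_mono) auto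
    then show "\<bar>q x - m x * \<eta> x\<bar> \<le> P + Q + M * H"
      using PQM(1) PQM(5)[OF x] by linarith
  qed
qed

section \<open>Subcritical parameters form an interval bounded by \<open>m\<close>\<close>

definition subcritical :: "real \<Rightarrow> bool" where
  "subcritical \<kappa> \<longleftrightarrow>
     (\<exists>u v. sol \<kappa> u v \<and> u T1 = 1 \<and> v T1 = 0 \<and> (\<forall>t\<in>{T1..T2}. 0 < u t) \<and> 0 \<le> v T2)"

text \<open>Compare with the solution \<open>u\<close> shot from \<open>T1\<close>. As long as
  \<open>u > 0\<close>, the Wronskian \<open>W\<close> is nondecreasing from
  \<open>- x T1 >= 0\<close>; so \<open>u / w\<close>, whose derivative is
  \<open>W / (p w\<^sup>2)\<close>, does not decrease and \<open>u\<close> cannot reach 0.\<close>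

lemma subcritical_supersolution:
  assumes w_pos: "\<And>t. t \<in> {T1..T2} \<Longrightarrow> 0 < w t"
    and wx: "continuous_on {T1..T2} w" "continuous_on {T1..T2} x"
    and w': "\<And>t. t \<in> {T1<..<T2} \<Longrightarrow> (w has_real_derivative 1 / p t * x t) (at t)"
    and x': "\<And>t. t \<in> {T1<..<T2} \<Longrightarrow>
               (x has_real_derivative D t) (at t) \<and> D t \<le> (q t - \<kappa> * m t) * w t"
    and bc: "x T1 \<le> 0" "0 \<le> x T2"
  shows "subcritical \<kappa>"
proof -
  obtain u v where uv: "sol \<kappa> u v" "u T1 = 1" "v T1 = 0" using sol_exists by blast
  note u = lin_solD[OF uv(1)]
  define W where "W t = w t * v t - u t * x t" for t
  have W_cont: "continuous_on {T1..T2} W" unfolding W_def by (intro continuous_intros u wx)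
  have W_nonneg: "0 \<le> W c" if c: "c \<in> {T1..T2}" and pos: "\<And>t. t \<in> {T1..<c} \<Longrightarrow> 0 < u t" for c
  proof -
    have "W T1 \<le> W c"
    proof (rule DERIV_nonneg_imp_increasing_open[of T1 c W])
      fix t assume t: "T1 < t" "t < c"
      then have t': "t \<in> {T1<..<T2}" using c by simp
      have "(W has_real_derivative u t * ((q t - \<kappa> * m t) * w t - D t)) (at t)"
        unfolding W_def
        by (rule derivative_eq_intros u(3,4)[OF t'] w'[OF t'] x'[OF t', THEN conjunct1] refl
            | simp add: algebra_simps)+
      moreover have "0 \<le> u t * ((q t - \<kappa> * m t) * w t - D t)"
        using x'[OF t'] pos[of t] t by (intro mult_nonneg_nonneg) auto
      ultimately show "\<exists>y. (W has_real_derivative y) (at t) \<and> 0 \<le> y" by blast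
    qed (use c continuous_on_subset[OF W_cont] in auto)
    with bc(1) uv show ?thesis by (simp add: W_def)
  qed
  \<comment> \<open>The signs of \<open>W\<close> and \<open>u\<close> depend on each other. The
    circle is broken by showing that positivity before \<open>c\<close> extends to \<open>c\<close>,
    and applying this to the first possible zero.\<close>
  have step: "0 < u c" if c: "c \<in> {T1..T2}" and pos: "\<And>t. t \<in> {T1..<c} \<Longrightarrow> 0 < u t" for c
  proof -
    have "u T1 / w T1 \<le> u c / w c"
    proof (rule DERIV_nonneg_imp_increasing_open[of T1 c "\<lambda>t. u t / w t"])
      fix t assume t: "T1 < t" "t < c"
      then have t': "t \<in> {T1<..<T2}" "t \<in> {T1..T2}" using c by auto
      have "((\<lambda>t. u t / w t) has_real_derivative
          (1 / p t * v t * w t - u t * (1 / p t * x t)) / (w t * w t)) (at t)"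
        using w_pos[OF t'(2)] by (intro DERIV_divide u(3) w' t'(1)) simp
      moreover have "1 / p t * v t * w t - u t * (1 / p t * x t) = 1 / p t * W t"
        by (simp add: W_def algebra_simps diff_divide_distrib)
      moreover have "0 \<le> W t" using pos t by (intro W_nonneg t'(2)) auto
      ultimately show "\<exists>y. ((\<lambda>t. u t / w t) has_real_derivative y) (at t) \<and> 0 \<le> y"
        using p_pos[OF t'(2)] by (metis divide_nonneg_nonneg less_imp_le mult_nonneg_nonneg zero_le_one zero_le_square)
    next
      have "continuous_on {T1..T2} (\<lambda>t. u t / w t)"
        using u(1) wx(1) w_pos by (intro continuous_intros) force+
      then show "continuous_on {T1..c} (\<lambda>t. u t / w t)"
        using c by (elim continuous_on_subset) auto
    qed (use c in simp)
    moreover have "0 < u T1 / w T1" using uv w_pos[of T1] T by simp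
    ultimately have "0 < u c / w c" by linarith
    then show ?thesis using w_pos[OF c] by (simp add: zero_less_divide_iff)
  qed
  have u_pos: "0 < u t" if t: "t \<in> {T1..T2}" for t
  proof -
    obtain d where d: "d \<in> {T1..T2}" "\<And>t. t \<in> {T1..<d} \<Longrightarrow> 0 < u t" "u d = 0 \<or> d = T2"
      using first_nonpositive_point[OF u(1)] T uv(2) by auto
    have "0 < u d" using d(1,2) by (rule step)
    then have "d = T2" using d(3) by simp
    then show ?thesis using \<open>0 < u d\<close> d(2)[of t] t by (cases "t = d") auto
  qed
  have "0 \<le> W T2" using T u_pos by (intro W_nonneg) auto
  moreover have "0 \<le> u T2 * x T2" using bc(2) u_pos[of T2] T by simp
  ultimately have "0 \<le> w T2 * v T2" by (simp add: W_def)
  then have "0 \<le> v T2" using w_pos[of T2] T by (simp add: zero_le_mult_iff)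
  with uv u_pos show ?thesis unfolding subcritical_def by blast
qed

text \<open>The constant 1 is a supersolution because \<open>q >= 0\<close>. Besides
  \<open>\<kappa> = 0\<close>, this captures every \<open>\<kappa>\<close> of sign opposite to an
  \<open>m\<close> of constant sign.\<close>

lemma subcritical_of_nonpos:
  assumes "\<And>t. t \<in> {T1..T2} \<Longrightarrow> \<kappa> * m t \<le> 0"
  shows "subcritical \<kappa>"
proof (rule subcritical_supersolution[where w = "\<lambda>_. 1" and x = "\<lambda>_. 0" and D = "\<lambda>_. 0"])
  fix t assume "t \<in> {T1<..<T2}"
  then show "((\<lambda>_. 0) has_real_derivative 0) (at t) \<and> 0 \<le> (q t - \<kappa> * m t) * 1"
    using assms[of t] q_nonneg[of t] by simp
qed auto

text \<open>The quotient \<open>r = v / u\<close> solves the Riccati equation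
  \<open>r' = (q - \<kappa> m) - r\<^sup>2 / p\<close>, affine in \<open>\<kappa>\<close> and
  concave in \<open>r\<close>. Averaging two such quotients gives a Riccati inequality for the
  averaged parameter; exponentiating turns the average into a geometric mean.\<close>

lemma subcritical_convex:
  assumes "subcritical \<kappa>0" "subcritical \<kappa>1" and \<theta>: "0 \<le> \<theta>" "\<theta> \<le> 1"
  shows "subcritical ((1 - \<theta>) * \<kappa>0 + \<theta> * \<kappa>1)"
proof -
  obtain u0 v0 where s0: "sol \<kappa>0 u0 v0" "v0 T1 = 0" "\<And>t. t \<in> {T1..T2} \<Longrightarrow> 0 < u0 t" "0 \<le> v0 T2"
    using assms(1) unfolding subcritical_def by blast
  obtain u1 v1 where s1: "sol \<kappa>1 u1 v1" "v1 T1 = 0" "\<And>t. t \<in> {T1..T2} \<Longrightarrow> 0 < u1 t" "0 \<le> v1 T2"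
    using assms(2) unfolding subcritical_def by blast
  note d0 = lin_solD[OF s0(1)] and d1 = lin_solD[OF s1(1)]
  \<comment> \<open>the weighted geometric mean of \<open>u0\<close> and \<open>u1\<close>; its logarithmic derivative is \<open>r / p\<close>\<close>
  define w where "w t = exp ((1 - \<theta>) * ln (u0 t) + \<theta> * ln (u1 t))" for t
  define r where "r t = (1 - \<theta>) * (v0 t / u0 t) + \<theta> * (v1 t / u1 t)" for t
  define R where "R t = (1 - \<theta>) * (v0 t / u0 t)\<^sup>2 + \<theta> * (v1 t / u1 t)\<^sup>2" for t
  let ?\<kappa> = "(1 - \<theta>) * \<kappa>0 + \<theta> * \<kappa>1"
  have w_pos: "0 < w t" for t by (simp add: w_def)
  have w': "(w has_real_derivative 1 / p t * (r t * w t)) (at t)" if t: "t \<in> {T1<..<T2}" for t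
  proof -
    have "(w has_real_derivative w t * ((1 - \<theta>) * (1 / u0 t * (1 / p t * v0 t)) + \<theta> * (1 / u1 t * (1 / p t * v1 t)))) (at t)"
      unfolding w_def using s0(3)[of t] s1(3)[of t] t
      by (intro DERIV_chain2[OF DERIV_exp] DERIV_add DERIV_cmult DERIV_chain2[OF DERIV_ln_divide]
          d0(3)[OF t] d1(3)[OF t]) auto
    then show ?thesis by (simp add: r_def algebra_simps diff_divide_distrib)
  qed
  have r': "(r has_real_derivative (q t - ?\<kappa> * m t) - 1 / p t * R t) (at t)" if t: "t \<in> {T1<..<T2}" for t
  proof -
    have quot: "((\<lambda>t. v t / u t) has_real_derivative (q t - \<kappa> * m t) - 1 / p t * (v t / u t)\<^sup>2) (at t)"
      if "sol \<kappa> u v" "0 < u t" for \<kappa> u v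
    proof -
      have "((\<lambda>t. v t / u t) has_real_derivative
          ((q t - \<kappa> * m t) * u t * u t - v t * (1 / p t * v t)) / (u t * u t)) (at t)"
        using that by (intro DERIV_divide lin_solD(3,4)[OF that(1) t]) simp
      moreover have "((q t - \<kappa> * m t) * u t * u t - v t * (1 / p t * v t)) / (u t * u t) =
          (q t - \<kappa> * m t) - 1 / p t * (v t / u t)\<^sup>2"
        using that(2) p_pos[of t] t by (simp add: field_simps power2_eq_square)
      ultimately show ?thesis by simp
    qed
    have "(r has_real_derivative (1 - \<theta>) * ((q t - \<kappa>0 * m t) - 1 / p t * (v0 t / u0 t)\<^sup>2) +
        \<theta> * ((q t - \<kappa>1 * m t) - 1 / p t * (v1 t / u1 t)\<^sup>2)) (at t)"
      unfolding r_def using t s0 s1 by (intro DERIV_add DERIV_cmult quot) auto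
    moreover have "(1 - \<theta>) * ((q t - \<kappa>0 * m t) - 1 / p t * (v0 t / u0 t)\<^sup>2) +
        \<theta> * ((q t - \<kappa>1 * m t) - 1 / p t * (v1 t / u1 t)\<^sup>2) = (q t - ?\<kappa> * m t) - 1 / p t * R t"
      by (simp add: R_def algebra_simps add_divide_distrib diff_divide_distrib)
    ultimately show ?thesis by simp
  qed
  show ?thesis
  proof (rule subcritical_supersolution[where w = w and x = "\<lambda>t. r t * w t"
        and D = "\<lambda>t. ((q t - ?\<kappa> * m t) - 1 / p t * R t) * w t + r t * (1 / p t * (r t * w t))"])
    show wc: "continuous_on {T1..T2} w"
      unfolding w_def using s0(3) s1(3) by (intro continuous_intros d0 d1) force+
    show "continuous_on {T1..T2} (\<lambda>t. r t * w t)"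
      unfolding r_def using s0(3) s1(3) by (intro continuous_intros d0 d1 wc) force+
    show "r T1 * w T1 \<le> 0" using s0(2) s1(2) by (simp add: r_def)
    show "0 \<le> r T2 * w T2"
      using s0(3)[of T2] s1(3)[of T2] s0(4) s1(4) \<theta> T w_pos[of T2] by (simp add: r_def)
    fix t assume t: "t \<in> {T1<..<T2}"
    show "(w has_real_derivative 1 / p t * (r t * w t)) (at t)" using w'[OF t] .
    \<comment> \<open>Variance identity: a mean of squares is at least the square of the
      mean.\<close>
    have "R t - (r t)\<^sup>2 = \<theta> * (1 - \<theta>) * (v0 t / u0 t - v1 t / u1 t)\<^sup>2"
      unfolding R_def r_def by algebra
    then have "(r t)\<^sup>2 \<le> R t" using \<theta> by (metis diff_ge_0_iff_ge mult_nonneg_nonneg zero_le_power2)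
    then have "1 / p t * w t * (r t)\<^sup>2 \<le> 1 / p t * w t * R t"
      using p_pos[of t] t w_pos[of t] by (intro mult_left_mono) auto
    then have "((q t - ?\<kappa> * m t) - 1 / p t * R t) * w t + r t * (1 / p t * (r t * w t))
        \<le> (q t - ?\<kappa> * m t) * w t"
      by (simp add: algebra_simps power2_eq_square)
    then show "((\<lambda>t. r t * w t) has_real_derivative
        ((q t - ?\<kappa> * m t) - 1 / p t * R t) * w t + r t * (1 / p t * (r t * w t))) (at t) \<and>
        ((q t - ?\<kappa> * m t) - 1 / p t * R t) * w t + r t * (1 / p t * (r t * w t)) \<le> (q t - ?\<kappa> * m t) * w t"
      using DERIV_mult[OF r'[OF t] w'[OF t]] by (simp add: algebra_simps)
  qed (rule w_pos)
qed

lemma subcritical_between: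
  assumes "subcritical \<kappa>0" "subcritical \<kappa>1" "\<kappa>0 \<le> \<kappa>" "\<kappa> \<le> \<kappa>1"
  shows "subcritical \<kappa>"
proof (cases "\<kappa>0 = \<kappa>1")
  case False
  define \<theta> where "\<theta> = (\<kappa> - \<kappa>0) / (\<kappa>1 - \<kappa>0)"
  have "(1 - \<theta>) * \<kappa>0 + \<theta> * \<kappa>1 = \<kappa>0 + \<theta> * (\<kappa>1 - \<kappa>0)" by (simp add: algebra_simps)
  also have "\<dots> = \<kappa>" using False by (simp add: \<theta>_def)
  finally show ?thesis
    using subcritical_convex[OF assms(1,2), of \<theta>] assms(3,4) False by (simp add: \<theta>_def)
qed (use assms in auto)

text \<open>Near \<open>t0\<close> the weight is at least \<open>\<delta>\<close>; for large
  \<open>\<kappa>\<close> a solution rotates so fast in the phase plane there that it cannot stay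
  positive.\<close>

lemma subcritical_bounded:
  assumes t0: "t0 \<in> {T1..T2}" "0 < m t0"
  obtains C where "\<And>\<kappa>. subcritical \<kappa> \<Longrightarrow> \<kappa> \<le> C"
proof -
  define \<delta> where "\<delta> = m t0 / 2"
  have \<delta>: "0 < \<delta>" using t0 by (simp add: \<delta>_def)
  obtain \<rho> where \<rho>: "0 < \<rho>" "\<And>t. t \<in> {T1..T2} \<Longrightarrow> dist t t0 < \<rho> \<Longrightarrow> dist (m t) (m t0) < \<delta>"
    using m t0(1) \<delta> unfolding continuous_on_iff by blast
  define a where "a = max T1 (t0 - \<rho> / 2)"
  define b where "b = min T2 (t0 + \<rho> / 2)"
  have ab: "T1 \<le> a" "a < b" "b \<le> T2" using t0 \<rho>(1) T by (auto simp: a_def b_def)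
  have m_ge: "\<delta> \<le> m t" if "t \<in> {a..b}" for t
  proof -
    have "dist t t0 < \<rho>" "t \<in> {T1..T2}" using that \<rho>(1) by (auto simp: a_def b_def dist_real_def)
    then have "\<bar>m t - m t0\<bar> < \<delta>" using \<rho>(2)[of t] by (simp add: dist_real_def)
    then show ?thesis unfolding \<delta>_def by linarith
  qed
  obtain P where P: "\<And>t. t \<in> {T1..T2} \<Longrightarrow> norm (p t) \<le> P"
    using continuous_on_compact_bound[OF compact_Icc p] by blast
  obtain Q where Q: "0 \<le> Q" "\<And>t. t \<in> {T1..T2} \<Longrightarrow> norm (q t) \<le> Q"
    using continuous_on_compact_bound[OF compact_Icc q] by blast
  define k where "k = 1 / P"
  have "0 < P" using P[OF t0(1)] p_pos[OF t0(1)] by simp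
  then have k: "0 < k" by (simp add: k_def)
  have k_le: "k \<le> 1 / p t" if "t \<in> {T1..T2}" for t
    unfolding k_def using P[OF that] p_pos[OF that] by (simp add: frac_le)
  \<comment> \<open>Chosen so that the total drop \<open>s k (b - a)\<close> is \<open>pi\<close>,
    the length of the open range of \<open>arctan\<close>, which no difference of two of its values
    reaches.\<close>
  define s where "s = pi / (k * (b - a))"
  have s: "0 < s" "s * k * (b - a) = pi" using k ab by (auto simp: s_def)
  show ?thesis
  \<comment> \<open>This threshold makes \<open>q - \<kappa> m <= - k s\<^sup>2\<close> on
    \<open>{a..b}\<close> for every larger \<open>\<kappa>\<close>.\<close>
  proof (rule that[of "(Q + k * s\<^sup>2) / \<delta>"], rule ccontr)
    fix \<kappa> assume "subcritical \<kappa>" and "\<not> \<kappa> \<le> (Q + k * s\<^sup>2) / \<delta>"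
    then have l: "Q + k * s\<^sup>2 < \<kappa> * \<delta>" using \<delta> by (simp add: field_simps)
    moreover have "0 \<le> k * s\<^sup>2" using k by simp
    ultimately have "0 < \<kappa> * \<delta>" using Q(1) by linarith
    then have l0: "0 < \<kappa>" using \<delta> by (simp add: zero_less_mult_iff)
    obtain u v where uv: "sol \<kappa> u v" "\<And>t. t \<in> {T1..T2} \<Longrightarrow> 0 < u t"
      using \<open>subcritical \<kappa>\<close> unfolding subcritical_def by blast
    note d = lin_solD[OF uv(1)]
    \<comment> \<open>The Riccati bound \<open>r' \<le> - k (s\<^sup>2 + r\<^sup>2)\<close> for \<open>r = v / u\<close> makes \<open>arctan (r / s)\<close>
      drop at rate \<open>s k\<close>, which exhausts its range within length \<open>b - a\<close>.\<close>
    define A where "A t = arctan (v t / u t / s) + s * k * t" for t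
    have "A b \<le> A a"
    proof (rule DERIV_nonpos_imp_decreasing_open[of a b A])
      fix t assume t: "a < t" "t < b"
      then have t': "t \<in> {T1<..<T2}" "t \<in> {T1..T2}" "t \<in> {a..b}" using ab by auto
      define r where "r = v t / u t"
      define \<beta> where "\<beta> = q t - \<kappa> * m t"
      have "\<kappa> * \<delta> \<le> \<kappa> * m t" using l0 m_ge[OF t'(3)] by simp
      then have \<beta>: "\<beta> \<le> - (k * s\<^sup>2)" using Q(2)[OF t'(2)] l unfolding \<beta>_def real_norm_def by linarith
      have "((\<lambda>t. v t / u t) has_real_derivative
          (\<beta> * u t * u t - v t * (1 / p t * v t)) / (u t * u t)) (at t)"
        unfolding \<beta>_def using uv(2)[OF t'(2)] by (intro DERIV_divide d(3,4)[OF t'(1)]) simp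
      moreover have "(\<beta> * u t * u t - v t * (1 / p t * v t)) / (u t * u t) = \<beta> - 1 / p t * r\<^sup>2"
        using uv(2)[OF t'(2)] p_pos[OF t'(2)] by (simp add: r_def field_simps power2_eq_square)
      ultimately have r': "((\<lambda>t. v t / u t) has_real_derivative \<beta> - 1 / p t * r\<^sup>2) (at t)" by simp
      have "((\<lambda>t. arctan (v t / u t / s) + s * k * t) has_real_derivative
          inverse (1 + (v t / u t / s)\<^sup>2) * ((\<beta> - 1 / p t * r\<^sup>2) / s) + s * k) (at t)"
        by (intro DERIV_add DERIV_chain2[OF DERIV_arctan] DERIV_cdivide r' DERIV_cmult_Id)
      then have A': "(A has_real_derivative
          inverse (1 + (r / s)\<^sup>2) * ((\<beta> - 1 / p t * r\<^sup>2) / s) + s * k) (at t)"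
        by (simp add: r_def A_def[abs_def])
      have "k * r\<^sup>2 \<le> 1 / p t * r\<^sup>2" using k_le[OF t'(2)] by (intro mult_right_mono) auto
      with \<beta> have "\<beta> - 1 / p t * r\<^sup>2 \<le> - (k * s\<^sup>2) - k * r\<^sup>2" by linarith
      also have "\<dots> = - (s * k) * s * (1 + (r / s)\<^sup>2)"
        using s(1) by (simp add: field_simps power2_eq_square)
      finally have "(\<beta> - 1 / p t * r\<^sup>2) / s \<le> - (s * k) * (1 + (r / s)\<^sup>2)"
        using s(1) by (simp add: pos_divide_le_eq mult_ac)
      then have "inverse (1 + (r / s)\<^sup>2) * ((\<beta> - 1 / p t * r\<^sup>2) / s) \<le>
          inverse (1 + (r / s)\<^sup>2) * (- (s * k) * (1 + (r / s)\<^sup>2))"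
        by (intro mult_left_mono) (auto simp: add_nonneg_nonneg)
      also have "\<dots> = - (s * k)"
        using add_pos_nonneg[of 1 "(r / s)\<^sup>2"] by simp
      finally show "\<exists>y. (A has_real_derivative y) (at t) \<and> y \<le> 0" using A' by force
    next
      have "continuous_on {T1..T2} A"
        unfolding A_def using uv(2) s(1) by (intro continuous_intros d) force+
      then show "continuous_on {a..b} A" using ab by (elim continuous_on_subset) auto
    qed (use ab in simp)
    then have "pi \<le> arctan (v a / u a / s) - arctan (v b / u b / s)"
      using s(2) by (simp add: A_def algebra_simps)
    then show False
      using arctan_bounded[of "v a / u a / s"] arctan_bounded[of "v b / u b / s"] by linarith
  qed
qed

subsection \<open>Extremal principal eigenvalues\<close>

text \<open>An eigenfunction without zeros keeps its sign, so dividing by its value at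
  \<open>T1\<close> makes it positive; the condition at \<open>T2\<close> then holds with
  equality.\<close>

lemma principal_eigenvalue_imp_subcritical:
  assumes "principal_eigenvalue T1 T2 p q m \<mu>"
  shows "subcritical \<mu>"
proof -
  obtain y where y: "neumann_solution T1 T2 p q (\<lambda>t. \<mu> * m t * y t) y" "\<And>t. t \<in> {T1..T2} \<Longrightarrow> y t \<noteq> 0"
    using assms unfolding principal_eigenvalue_def by blast
  obtain w where w: "sol \<mu> y w" "w T1 = 0" "w T2 = 0"
    using y(1) unfolding neumann_solution_iff by blast
  define c where "c = 1 / y T1"
  have y1: "y T1 \<noteq> 0" using y(2) T by simp
  have s: "sol \<mu> (\<lambda>t. c * y t) (\<lambda>t. c * w t)" by (rule lin_sol_scale[OF w(1)])
  have "0 < c * y t" if t: "t \<in> {T1..T2}" for t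
  proof (rule ccontr)
    assume "\<not> 0 < c * y t"
    moreover have "continuous_on {T1..t} (\<lambda>t. c * y t)"
      using lin_solD(1)[OF s] t by (elim continuous_on_subset) auto
    ultimately obtain x where "T1 \<le> x" "x \<le> t" "c * y x = 0"
      using IVT2'[of "\<lambda>t. c * y t" t 0 T1] t y1 by (auto simp: c_def)
    then show False using y(2)[of x] t y1 by (auto simp: c_def)
  qed
  with s w y1 show ?thesis unfolding subcritical_def
    by (intro exI[of _ "\<lambda>t. c * y t"] exI[of _ "\<lambda>t. c * w t"]) (auto simp: c_def)
qed

text \<open>Passing to the supremum \<open>l\<close> gives only \<open>u >= 0\<close> and
  \<open>v T2 >= 0\<close>. Uniqueness makes the first strict, since \<open>v\<close> would vanish
  wherever \<open>u\<close> does. The second must be an equality, as otherwise a slightly larger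
  parameter would be subcritical.\<close>

lemma maximal_subcritical:
  assumes t0: "t0 \<in> {T1..T2}" "0 < m t0"
  shows "\<exists>l. principal_eigenvalue T1 T2 p q m l \<and> (\<forall>\<kappa>. subcritical \<kappa> \<longrightarrow> \<kappa> \<le> l)"
proof -
  obtain C where C: "\<And>\<kappa>. subcritical \<kappa> \<Longrightarrow> \<kappa> \<le> C" using subcritical_bounded[OF t0] by blast
  have "subcritical 0" by (rule subcritical_of_nonpos) simp
  define l where "l = Sup {\<kappa>. subcritical \<kappa>}"
  have ne: "{\<kappa>. subcritical \<kappa>} \<noteq> {}" and bdd: "bdd_above {\<kappa>. subcritical \<kappa>}"
    using \<open>subcritical 0\<close> C by (auto intro: bdd_aboveI[of _ C])
  have le_l: "\<kappa> \<le> l" if "subcritical \<kappa>" for \<kappa>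
    unfolding l_def using that bdd by (intro cSup_upper) auto
  obtain u v where uv: "sol l u v" "u T1 = 1" "v T1 = 0" using sol_exists by blast
  note d = lin_solD[OF uv(1)]
  have "T1 \<in> {T1..T2}" using T by simp
  from sol_dependence[OF uv(1) this] obtain K where K: "0 < K"
    "\<And>\<kappa> y w t. \<lbrakk>\<bar>\<kappa> - l\<bar> \<le> 1; sol \<kappa> y w; y T1 = u T1; w T1 = v T1; t \<in> {T1..T2}\<rbrakk>
       \<Longrightarrow> \<bar>y t - u t\<bar> \<le> K * \<bar>\<kappa> - l\<bar> \<and> \<bar>w t - v t\<bar> \<le> K * \<bar>\<kappa> - l\<bar>" by blast
  have approx: "- e \<le> u t \<and> - e \<le> v T2" if e: "0 < e" and t: "t \<in> {T1..T2}" for e t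
  proof -
    define \<epsilon> where "\<epsilon> = min 1 (e / K)"
    have "0 < \<epsilon>" using e K(1) by (simp add: \<epsilon>_def)
    then obtain \<kappa> where \<kappa>: "subcritical \<kappa>" "l - \<epsilon> < \<kappa>"
      using less_cSup_iff[OF ne bdd, of "l - \<epsilon>"] by (auto simp: l_def)
    have near: "\<bar>\<kappa> - l\<bar> \<le> \<epsilon>" using le_l[OF \<kappa>(1)] \<kappa>(2) by simp
    have "K * \<bar>\<kappa> - l\<bar> \<le> K * (e / K)" using near K(1) by (intro mult_left_mono) (auto simp: \<epsilon>_def)
    then have Ke: "K * \<bar>\<kappa> - l\<bar> \<le> e" using K(1) by simp
    obtain y w where yw: "sol \<kappa> y w" "y T1 = 1" "w T1 = 0" "\<And>t. t \<in> {T1..T2} \<Longrightarrow> 0 < y t" "0 \<le> w T2"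
      using \<kappa>(1) unfolding subcritical_def by blast
    have n1: "\<bar>\<kappa> - l\<bar> \<le> 1" using near by (simp add: \<epsilon>_def)
    have eqs: "y T1 = u T1" "w T1 = v T1" using uv yw by auto
    show ?thesis
      using K(2)[OF n1 yw(1) eqs t] K(2)[OF n1 yw(1) eqs, of T2] Ke yw(4)[OF t] yw(5) T by auto
  qed
  have u_nonneg: "0 \<le> u t" if t: "t \<in> {T1..T2}" for t
  proof (rule field_le_epsilon)
    show "0 \<le> u t + e" if "0 < e" for e using approx[OF that t] by simp
  qed
  have v_nonneg: "0 \<le> v T2"
  proof (rule field_le_epsilon)
    show "0 \<le> v T2 + e" if "0 < e" for e using approx[OF that, of T2] T by simp
  qed
  have u_pos: "0 < u t" if t: "t \<in> {T1..T2}" for t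
  proof (rule ccontr)
    assume "\<not> 0 < u t"
    with u_nonneg[OF t] have ut: "u t = 0" by simp
    \<comment> \<open>An interior zero of the nonnegative \<open>u\<close> is a local minimum. At
      \<open>T2\<close> a positive \<open>v T2\<close> would instead make \<open>u\<close> negative
      just to the left.\<close>
    have "v t = 0"
    proof (cases "t = T2")
      case True
      show ?thesis
      proof (rule ccontr)
        assume "v t \<noteq> 0"
        with v_nonneg True have "0 < 1 / p t * v t" using p_pos[OF t] by simp
        from has_real_derivative_pos_inc_left[OF d(5)[OF t] this] obtain \<delta> where
          \<delta>: "0 < \<delta>" "\<And>h. 0 < h \<Longrightarrow> t - h \<in> {T1..T2} \<Longrightarrow> h < \<delta> \<Longrightarrow> u (t - h) < u t" by blast
        define h where "h = min (\<delta> / 2) (T2 - T1)"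
        have "0 < h" "t - h \<in> {T1..T2}" "h < \<delta>" using \<delta>(1) T True by (auto simp: h_def)
        then show False using \<delta>(2)[of h] u_nonneg[of "t - h"] ut by simp
      qed
    next
      case False
      moreover have "t \<noteq> T1" using ut uv(2) by auto
      ultimately have t': "t \<in> {T1<..<T2}" using t by auto
      have "1 / p t * v t = 0"
      proof (rule DERIV_local_min[OF d(3)[OF t'], of "min (t - T1) (T2 - t)"])
        show "\<forall>y. \<bar>t - y\<bar> < min (t - T1) (T2 - t) \<longrightarrow> u t \<le> u y"
        proof (intro allI impI)
          fix y assume "\<bar>t - y\<bar> < min (t - T1) (T2 - t)"
          then have "y \<in> {T1..T2}" by auto
          then show "u t \<le> u y" using u_nonneg ut by simp
        qed
      qed (use t' in auto)
      then show ?thesis using p_pos[OF t] by simp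
    qed
    then have "u T1 = 0"
      using uv(1) t ut T
      by (intro sol_zero[of "\<lambda>_. l" u v "\<bar>l\<bar>" t T1]) (auto simp: mult.commute)
    then show False using uv(2) by simp
  qed
  have "v T2 = 0"
  proof (rule ccontr)
    assume "v T2 \<noteq> 0"
    with v_nonneg have v2: "0 < v T2" by simp
    obtain x where x: "x \<in> {T1..T2}" "\<And>t. t \<in> {T1..T2} \<Longrightarrow> u x \<le> u t"
      using continuous_attains_inf[OF compact_Icc _ d(1)] T by auto
    \<comment> \<open>Moves the solution by at most half of its minimum and half of
      \<open>v T2\<close>, so both remain positive.\<close>
    define \<epsilon> where "\<epsilon> = min 1 (min (u x) (v T2) / (2 * K))"
    have \<epsilon>: "0 < \<epsilon>" "\<epsilon> \<le> 1" using K(1) v2 u_pos[OF x(1)] by (auto simp: \<epsilon>_def)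
    have "K * \<epsilon> \<le> K * (min (u x) (v T2) / (2 * K))" using K(1) by (intro mult_left_mono) (auto simp: \<epsilon>_def)
    also have "\<dots> < min (u x) (v T2)" using K(1) v2 u_pos[OF x(1)] by (simp add: min_def)
    finally have Ke: "K * \<bar>(l + \<epsilon>) - l\<bar> < min (u x) (v T2)" using \<epsilon>(1) by simp
    obtain y w where yw: "sol (l + \<epsilon>) y w" "y T1 = 1" "w T1 = 0" using sol_exists by blast
    have close: "\<bar>y t - u t\<bar> < min (u x) (v T2) \<and> \<bar>w t - v t\<bar> < min (u x) (v T2)"
      if "t \<in> {T1..T2}" for t
      using K(2)[OF _ yw(1) _ _ that] Ke \<epsilon> uv yw by force
    have "0 < y t" if "t \<in> {T1..T2}" for t using close[OF that] x(2)[OF that] by linarith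
    moreover have "0 \<le> w T2" using close[of T2] T by auto
    ultimately have "subcritical (l + \<epsilon>)" unfolding subcritical_def using yw by blast
    from le_l[OF this] \<epsilon>(1) show False by simp
  qed
  then have "neumann_solution T1 T2 p q (\<lambda>t. l * m t * u t) u"
    unfolding neumann_solution_iff using uv by blast
  then have "principal_eigenvalue T1 T2 p q m l"
    unfolding principal_eigenvalue_def using u_pos by force
  with le_l show ?thesis by blast
qed

text \<open>The maximal subcritical parameter is a principal eigenvalue and every principal
  eigenvalue is subcritical; so the \<open>GREATEST\<close> in the definition exists and is that
  maximum.\<close>

lemma lambda_pos:
  assumes "t0 \<in> {T1..T2}" "0 < m t0"
  shows "subcritical (lambda_pos T1 T2 p q m)"
    and "subcritical \<kappa> \<Longrightarrow> \<kappa> \<le> lambda_pos T1 T2 p q m"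
proof -
  obtain l where l: "principal_eigenvalue T1 T2 p q m l" "\<And>\<kappa>. subcritical \<kappa> \<Longrightarrow> \<kappa> \<le> l"
    using maximal_subcritical[OF assms] by blast
  then have "lambda_pos T1 T2 p q m = l"
    unfolding lambda_pos_def
    by (intro Greatest_equality) (auto intro: principal_eigenvalue_imp_subcritical)
  with l show "subcritical (lambda_pos T1 T2 p q m)" "subcritical \<kappa> \<Longrightarrow> \<kappa> \<le> lambda_pos T1 T2 p q m"
    using principal_eigenvalue_imp_subcritical by auto
qed

text \<open>Replacing \<open>m\<close> by \<open>- m\<close> changes the sign of the parameter,
  which turns the maximum into the minimum.\<close>

lemma lambda_neg:
  assumes "t0 \<in> {T1..T2}" "m t0 < 0"
  shows "subcritical (lambda_neg T1 T2 p q m)"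
    and "subcritical \<kappa> \<Longrightarrow> lambda_neg T1 T2 p q m \<le> \<kappa>"
proof -
  interpret N: neumann_data T1 T2 p q "\<lambda>t. - m t"
    using T p q m p_pos q_nonneg by unfold_locales (auto intro: continuous_intros)
  have sub: "N.subcritical \<kappa> \<longleftrightarrow> subcritical (- \<kappa>)" for \<kappa>
    unfolding N.subcritical_def subcritical_def by simp
  have prin: "principal_eigenvalue T1 T2 p q (\<lambda>t. - m t) \<kappa> \<longleftrightarrow> principal_eigenvalue T1 T2 p q m (- \<kappa>)" for \<kappa>
    unfolding principal_eigenvalue_def by simp
  obtain l where l: "principal_eigenvalue T1 T2 p q m (- l)" "\<And>\<kappa>. subcritical (- \<kappa>) \<Longrightarrow> \<kappa> \<le> l"
    using N.maximal_subcritical[of t0] assms unfolding prin sub by auto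
  have l': "- l \<le> \<kappa>" if "subcritical \<kappa>" for \<kappa> using l(2)[of "- \<kappa>"] that by simp
  have "lambda_neg T1 T2 p q m = - l"
    unfolding lambda_neg_def using l(1)
    by (intro Least_equality) (auto intro: l' principal_eigenvalue_imp_subcritical)
  with l l' show "subcritical (lambda_neg T1 T2 p q m)" "subcritical \<kappa> \<Longrightarrow> lambda_neg T1 T2 p q m \<le> \<kappa>"
    using principal_eigenvalue_imp_subcritical by auto
qed

subsection \<open>Nodal intervals\<close>

definition positive_from :: "real \<Rightarrow> real \<Rightarrow> bool" where
  "positive_from s \<kappa> \<longleftrightarrow> (\<exists>u v. sol \<kappa> u v \<and> u s = 1 \<and> v s = 0 \<and> (\<forall>t\<in>{T1..T2}. 0 < u t))"

text \<open>On the compact interval \<open>u\<close> has a positive minimum \<open>u x\<close>;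
  \<open>\<epsilon>\<close> is chosen so that the solution moves by at most half of it.\<close>

lemma positive_from_open:
  assumes "positive_from s \<mu>" and s: "s \<in> {T1, T2}"
  shows "\<exists>\<epsilon>>0. \<forall>\<kappa>. \<bar>\<kappa> - \<mu>\<bar> \<le> \<epsilon> \<longrightarrow> positive_from s \<kappa>"
proof -
  obtain u v where uv: "sol \<mu> u v" "u s = 1" "v s = 0" "\<And>t. t \<in> {T1..T2} \<Longrightarrow> 0 < u t"
    using assms unfolding positive_from_def by blast
  have "s \<in> {T1..T2}" using s T by auto
  from sol_dependence[OF uv(1) this] obtain K where K: "0 < K"
    "\<And>\<kappa> y w t. \<lbrakk>\<bar>\<kappa> - \<mu>\<bar> \<le> 1; sol \<kappa> y w; y s = u s; w s = v s; t \<in> {T1..T2}\<rbrakk>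
       \<Longrightarrow> \<bar>y t - u t\<bar> \<le> K * \<bar>\<kappa> - \<mu>\<bar> \<and> \<bar>w t - v t\<bar> \<le> K * \<bar>\<kappa> - \<mu>\<bar>" by blast
  obtain x where x: "x \<in> {T1..T2}" "\<And>t. t \<in> {T1..T2} \<Longrightarrow> u x \<le> u t"
    using continuous_attains_inf[OF compact_Icc _ lin_solD(1)[OF uv(1)]] T by auto
  define \<epsilon> where "\<epsilon> = min 1 (u x / (2 * K))"
  have "0 < \<epsilon>" using K(1) uv(4)[OF x(1)] by (simp add: \<epsilon>_def)
  moreover have "positive_from s \<kappa>" if \<kappa>: "\<bar>\<kappa> - \<mu>\<bar> \<le> \<epsilon>" for \<kappa>
  proof -
    have "K * \<bar>\<kappa> - \<mu>\<bar> \<le> K * (u x / (2 * K))"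
      using K(1) \<kappa> by (intro mult_left_mono) (auto simp: \<epsilon>_def)
    also have "\<dots> < u x" using K(1) uv(4)[OF x(1)] by simp
    finally have Ke: "K * \<bar>\<kappa> - \<mu>\<bar> < u x" .
    obtain y w where yw: "sol \<kappa> y w" "y s = 1" "w s = 0" using sol_exists[OF s] by blast
    have "0 < y t" if t: "t \<in> {T1..T2}" for t
    proof -
      have "\<bar>y t - u t\<bar> \<le> K * \<bar>\<kappa> - \<mu>\<bar>"
        using K(2)[OF _ yw(1) _ _ t] \<kappa> uv yw by (auto simp: \<epsilon>_def)
      then show ?thesis using Ke x(2)[OF t] by linarith
    qed
    with yw show ?thesis unfolding positive_from_def by blast
  qed
  ultimately show ?thesis by blast
qed

text \<open>For \<open>s = T2\<close>: the Wronskian \<open>W\<close> is constant and equals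
  \<open>- v T2 <= 0\<close>, so \<open>y / u\<close> does not increase and is at least
  \<open>1 / u T2\<close>. This is where the sign condition at \<open>T2\<close> pays off.\<close>

lemma subcritical_imp_positive_from:
  assumes "subcritical \<kappa>" and s: "s \<in> {T1, T2}"
  shows "positive_from s \<kappa>"
proof -
  obtain u v where uv: "sol \<kappa> u v" "u T1 = 1" "v T1 = 0" "\<And>t. t \<in> {T1..T2} \<Longrightarrow> 0 < u t" "0 \<le> v T2"
    using assms(1) unfolding subcritical_def by blast
  obtain y w where yw: "sol \<kappa> y w" "y T2 = 1" "w T2 = 0" using sol_exists by blast
  note du = lin_solD[OF uv(1)] and dy = lin_solD[OF yw(1)]
  define W where "W t = u t * w t - y t * v t" for t
  have W_cont: "continuous_on {T1..T2} W" unfolding W_def by (intro continuous_intros du dy)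
  have W': "(W has_real_derivative 0) (at t)" if "T1 < t" "t < T2" for t
    unfolding W_def using that by (auto intro!: derivative_eq_intros du(3,4) dy(3,4) simp: algebra_simps)
  have W_eq: "W t = W T1" if "t \<in> {T1..T2}" for t
    using that T W_cont W' by (intro DERIV_isconst2[of T1 T2 W]) auto
  have W: "W t \<le> 0" if "t \<in> {T1..T2}" for t
    using W_eq[OF that] W_eq[of T2] T uv(5) yw by (simp add: W_def)
  have "0 < y t" if t: "t \<in> {T1..T2}" for t
  proof -
    have "y T2 / u T2 \<le> y t / u t"
    proof (rule DERIV_nonpos_imp_decreasing_open[of t T2 "\<lambda>t. y t / u t"])
      fix x assume x: "t < x" "x < T2"
      then have x': "x \<in> {T1<..<T2}" "x \<in> {T1..T2}" using t by auto
      have "((\<lambda>t. y t / u t) has_real_derivative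
          (1 / p x * w x * u x - y x * (1 / p x * v x)) / (u x * u x)) (at x)"
        using uv(4)[OF x'(2)] by (intro DERIV_divide du(3) dy(3) x'(1)) simp
      moreover have "1 / p x * w x * u x - y x * (1 / p x * v x) = 1 / p x * W x"
        by (simp add: W_def algebra_simps diff_divide_distrib)
      moreover have "1 / p x * W x / (u x * u x) \<le> 0"
        using W[OF x'(2)] p_pos[OF x'(2)]
        by (intro divide_nonpos_nonneg mult_nonneg_nonpos) auto
      ultimately show "\<exists>D. ((\<lambda>t. y t / u t) has_real_derivative D) (at x) \<and> D \<le> 0" by auto
    next
      have "continuous_on {T1..T2} (\<lambda>t. y t / u t)"
        using du(1) dy(1) uv(4) by (intro continuous_intros) force+
      then show "continuous_on {t..T2} (\<lambda>t. y t / u t)" using t by (elim continuous_on_subset) auto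
    qed (use t in simp)
    moreover have "0 < y T2 / u T2" using yw(2) uv(4)[of T2] T by simp
    ultimately have "0 < y t / u t" by linarith
    then show ?thesis using uv(4)[OF t] by (simp add: zero_less_divide_iff)
  qed
  with uv yw s show ?thesis unfolding positive_from_def by blast
qed

text \<open>Where \<open>u > 0\<close>, (P) is the linear equation with parameter \<open>a\<close>.
  If \<open>u\<close> vanishes at both ends of a positive nodal interval, Rolle's theorem for
  \<open>u / y\<close> gives a zero of the Wronskian. Otherwise one end is \<open>T1\<close> or
  \<open>T2\<close>, where \<open>v\<close> and \<open>w\<close> both vanish once \<open>y\<close>
  is shot from that end. The interior zero \<open>z\<close> rules out that the nodal interval is
  everything.\<close>

lemma problem_P_not_positive:
  assumes P: "problem_P_solution T1 T2 p q m a b u" and nz: "not_identically_zero T1 T2 u"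
    and z: "z \<in> {T1<..<T2}" "u z = 0"
  shows "\<not> (positive_from T1 a \<and> positive_from T2 a)"
proof
  assume pf: "positive_from T1 a \<and> positive_from T2 a"
  \<comment> \<open>With this weight, which depends on \<open>u\<close>, problem \<open>(P)\<close> is a linear equation for \<open>u\<close>.\<close>
  define \<eta> where "\<eta> t = (if 0 \<le> u t then a else b)" for t
  have "(\<lambda>t. m t * (a * pos_part u t - b * neg_part u t)) = (\<lambda>t. (m t * \<eta> t) * u t)"
    by (auto simp: \<eta>_def pos_part_def neg_part_def fun_eq_iff)
  then have "neumann_solution T1 T2 p q (\<lambda>t. (m t * \<eta> t) * u t) u"
    using P unfolding problem_P_solution_def by simp
  then obtain v where v: "lin_sol T1 T2 (\<lambda>t. 1 / p t) (\<lambda>t. q t - m t * \<eta> t) u v" "v T1 = 0" "v T2 = 0"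
    unfolding neumann_solution_iff by blast
  note d = lin_solD[OF v(1)]
  have z': "z \<in> {T1..T2}" using z by simp
  \<comment> \<open>If \<open>u <= 0\<close> throughout, the zero \<open>z\<close> is a local
    maximum, so \<open>v z = 0\<close> too and uniqueness forces \<open>u\<close> to vanish.\<close>
  have "\<exists>x\<in>{T1..T2}. 0 < u x"
  proof (rule ccontr)
    assume "\<not> ?thesis"
    then have le: "\<And>x. x \<in> {T1..T2} \<Longrightarrow> u x \<le> 0" by force
    have "1 / p z * v z = 0"
    proof (rule DERIV_local_max[OF d(3)[OF z(1)], of "min (z - T1) (T2 - z)"])
      show "\<forall>y. \<bar>z - y\<bar> < min (z - T1) (T2 - z) \<longrightarrow> u y \<le> u z"
      proof (intro allI impI)
        fix y assume "\<bar>z - y\<bar> < min (z - T1) (T2 - z)"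
        then have "y \<in> {T1..T2}" by auto
        then show "u y \<le> u z" using le z(2) by simp
      qed
    qed (use z in auto)
    then have "v z = 0" using p_pos[OF z'] by simp
    moreover have "\<bar>\<eta> t\<bar> \<le> \<bar>a\<bar> + \<bar>b\<bar>" for t by (simp add: \<eta>_def)
    ultimately have "u t = 0" if "t \<in> {T1..T2}" for t
      using sol_zero[OF v(1) _ z' z(2) _ that] by blast
    then show False using nz by (auto simp: not_identically_zero_def)
  qed
  then obtain x where x: "x \<in> {T1..T2}" "0 < u x" by blast
  have x': "T1 \<le> x" "x \<le> T2" using x(1) by simp_all
  have cx: "continuous_on {T1..x} u" "continuous_on {x..T2} u"
    using d(1) x' by (auto elim: continuous_on_subset)
  obtain c where c: "c \<in> {T1..x}" "\<And>t. t \<in> {c<..x} \<Longrightarrow> 0 < u t" "u c = 0 \<or> c = T1"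
    using last_nonpositive_point[OF cx(1) x'(1) x(2)] by blast
  obtain e where e: "e \<in> {x..T2}" "\<And>t. t \<in> {x..<e} \<Longrightarrow> 0 < u t" "u e = 0 \<or> e = T2"
    using first_nonpositive_point[OF cx(2) x'(2) x(2)] by blast
  have pos: "0 < u t" if "t \<in> {c<..<e}" for t
    using c(2)[of t] e(2)[of t] that by (cases "t \<le> x") auto
  have ce: "c < e"
  proof (rule ccontr)
    assume "\<not> c < e"
    then have "c = x" "e = x" using c(1) e(1) by auto
    with c(3) e(3) x(2) T show False by auto
  qed
  have dir: "u c = 0 \<or> u e = 0"
  proof (rule ccontr)
    assume "\<not> ?thesis"
    with c(3) e(3) have "c = T1" "e = T2" by auto
    with pos[of z] z show False by simp
  qed
  have sub: "c \<in> {T1..T2}" "e \<in> {T1..T2}" using c(1) e(1) x(1) by auto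
  have "lin_sol c e (\<lambda>t. 1 / p t) (\<lambda>t. q t - m t * \<eta> t) u v"
    using lin_sol_subinterval[OF v(1)] sub by simp
  then have u: "lin_sol c e (\<lambda>t. 1 / p t) (\<lambda>t. q t - a * m t) u v"
    by (rule lin_sol_cong) (use pos in \<open>force simp: \<eta>_def mult.commute\<close>)
  \<comment> \<open>\<open>s\<close> is the boundary point of the whole interval at which the nodal
    interval ends, if there is one; with zeros of \<open>u\<close> at both ends either choice
    serves.\<close>
  obtain s where s: "s \<in> {T1, T2}" "(u c = 0 \<and> u e = 0) \<or> (s \<in> {c, e} \<and> v s = 0)"
    using c(3) e(3) v(2,3) dir by blast
  have "positive_from s a" using pf s(1) by auto
  then obtain y w where yw: "sol a y w" "w s = 0" "\<And>t. t \<in> {T1..T2} \<Longrightarrow> 0 < y t"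
    unfolding positive_from_def by blast
  have yw': "lin_sol c e (\<lambda>t. 1 / p t) (\<lambda>t. q t - a * m t) y w"
    using lin_sol_subinterval[OF yw(1)] sub by simp
  note dy = lin_solD[OF yw'] and du = lin_solD[OF u]
  have y_pos: "0 < y t" if "t \<in> {c..e}" for t using yw(3) that sub by simp
  have "\<exists>x\<in>{c..e}. y x * v x = u x * w x"
  proof (cases "u c = 0 \<and> u e = 0")
    case True
    have "\<exists>x. c < x \<and> x < e \<and> (\<lambda>h. (1 / p x * v x * y x - u x * (1 / p x * w x)) / (y x * y x) * h) = (\<lambda>h. 0)"
    proof (rule Rolle_deriv[OF ce, of "\<lambda>t. u t / y t"])
      show "continuous_on {c..e} (\<lambda>t. u t / y t)"
        using y_pos by (intro continuous_intros du dy) force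
      show "((\<lambda>t. u t / y t) has_derivative
          (\<lambda>h. (1 / p x * v x * y x - u x * (1 / p x * w x)) / (y x * y x) * h)) (at x)"
        if "c < x" "x < e" for x
        unfolding has_field_derivative_def[symmetric]
        using that y_pos[of x] by (intro DERIV_divide du(3) dy(3)) auto
    qed (use True in simp)
    then obtain x where x: "c < x" "x < e"
      "(1 / p x * v x * y x - u x * (1 / p x * w x)) / (y x * y x) * 1 = 0" by meson
    have "0 < y x" "0 < p x" using x y_pos[of x] p_pos[of x] sub by auto
    with x(3) have "y x * v x = u x * w x" by (simp add: field_simps)
    then show ?thesis using x by force
  next
    case False
    with s have "s \<in> {c, e}" "v s = 0" by auto
    with ce yw(2) show ?thesis by (intro bexI[of _ s]) auto
  qed
  then obtain x0 where x0: "x0 \<in> {c..e}" "y x0 * v x0 = u x0 * w x0" by blast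
  obtain s0 where s0: "s0 \<in> {c..e}" "u s0 = 0"
    using dir ce by (metis atLeastAtMost_iff less_imp_le order_refl)
  have "u ((c + e) / 2) = 0"
    using ce by (intro lin_sol_proportional[OF u yw' ce _ x0 s0] y_pos) (auto simp: field_simps)
  moreover have "0 < u ((c + e) / 2)" using ce by (intro pos) (simp add: field_simps)
  ultimately show False by simp
qed

text \<open>Changing the sign of \<open>u\<close> exchanges the roles of \<open>a\<close> and
  \<open>b\<close>, so what is proved for \<open>a\<close> on positive nodal intervals carries over
  to \<open>b\<close>.\<close>

lemma problem_P_uminus:
  assumes "problem_P_solution T1 T2 p q m a b u"
  shows "problem_P_solution T1 T2 p q m b a (\<lambda>t. - u t)"
proof -
  define \<eta> where "\<eta> t = (if 0 \<le> u t then a else b)" for t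
  have eq: "(\<lambda>t. m t * (a * pos_part u t - b * neg_part u t)) = (\<lambda>t. (m t * \<eta> t) * u t)"
    "(\<lambda>t. m t * (b * pos_part (\<lambda>t. - u t) t - a * neg_part (\<lambda>t. - u t) t)) = (\<lambda>t. (m t * \<eta> t) * (- u t))"
    by (auto simp: \<eta>_def pos_part_def neg_part_def fun_eq_iff)
  obtain v where v: "lin_sol T1 T2 (\<lambda>t. 1 / p t) (\<lambda>t. q t - m t * \<eta> t) u v" "v T1 = 0" "v T2 = 0"
    using assms unfolding problem_P_solution_def eq neumann_solution_iff by blast
  from lin_sol_scale[OF v(1), of "-1"] v(2,3) show ?thesis
    unfolding problem_P_solution_def eq neumann_solution_iff by (intro exI[of _ "\<lambda>t. - v t"]) simp
qed

section \<open>Location of \<open>Sigma_star\<close>\<close>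

lemma Sigma_star_not_positive:
  assumes "(a, b) \<in> Sigma_star T1 T2 p q m"
  shows "\<not> (positive_from T1 a \<and> positive_from T2 a)" "\<not> (positive_from T1 b \<and> positive_from T2 b)"
proof -
  obtain u k where u: "problem_P_solution T1 T2 p q m a b u" "not_identically_zero T1 T2 u"
      "has_exactly_zeros T1 T2 u k" "1 \<le> k"
    using assms by (auto simp: Sigma_star_def C_gt_def C_lt_def)
  from u(3,4) have "{t \<in> {T1<..<T2}. u t = 0} \<noteq> {}"
    unfolding has_exactly_zeros_def by (metis card.empty not_one_le_zero)
  then obtain z where z: "z \<in> {T1<..<T2}" "u z = 0" by blast
  show "\<not> (positive_from T1 a \<and> positive_from T2 a)"
    using problem_P_not_positive[OF u(1,2) z] .
  have "not_identically_zero T1 T2 (\<lambda>t. - u t)" using u(2) by (simp add: not_identically_zero_def)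
  then show "\<not> (positive_from T1 b \<and> positive_from T2 b)"
    using problem_P_not_positive[OF problem_P_uminus[OF u(1)]] z by simp
qed

text \<open>The source of the uniform gap: \<open>\<epsilon>\<close> comes from openness of
  positivity at \<open>l\<close> alone, hence is the same for all numbers of zeros, and it also
  excludes parameters just beyond an extremal \<open>l\<close> that are no longer
  subcritical.\<close>

lemma Sigma_star_gap:
  assumes "subcritical l"
  obtains \<epsilon> where "0 < \<epsilon>"
    "\<And>a b \<kappa>. \<lbrakk>(a, b) \<in> Sigma_star T1 T2 p q m; \<kappa> \<in> {a, b}\<rbrakk> \<Longrightarrow> \<not> subcritical \<kappa> \<and> \<epsilon> < \<bar>\<kappa> - l\<bar>"
proof -
  have pos: "positive_from T1 \<kappa> \<and> positive_from T2 \<kappa>" if "subcritical \<kappa>" for \<kappa>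
    using subcritical_imp_positive_from[OF that] by simp
  obtain \<epsilon>1 \<epsilon>2 where e: "0 < \<epsilon>1" "0 < \<epsilon>2" "\<And>\<kappa>. \<bar>\<kappa> - l\<bar> \<le> \<epsilon>1 \<Longrightarrow> positive_from T1 \<kappa>"
      "\<And>\<kappa>. \<bar>\<kappa> - l\<bar> \<le> \<epsilon>2 \<Longrightarrow> positive_from T2 \<kappa>"
    using positive_from_open[of T1 l] positive_from_open[of T2 l] pos[OF assms] by auto
  show ?thesis
  proof (rule that[of "min \<epsilon>1 \<epsilon>2"])
    fix a b \<kappa> assume "(a, b) \<in> Sigma_star T1 T2 p q m" "\<kappa> \<in> {a, b}"
    then have "\<not> (positive_from T1 \<kappa> \<and> positive_from T2 \<kappa>)" using Sigma_star_not_positive by blast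
    with pos e(3,4)[of \<kappa>] show "\<not> subcritical \<kappa> \<and> min \<epsilon>1 \<epsilon>2 < \<bar>\<kappa> - l\<bar>" by force
  qed (use e in simp)
qed

text \<open>For \<open>m >= 0\<close> a nonpositive \<open>\<kappa>\<close> is subcritical, so
  either alternative yields \<open>0 <= \<kappa>\<close>. Since 0 and \<open>lambda_pos\<close> are
  subcritical, so is everything between them; thus \<open>\<kappa>\<close> exceeds
  \<open>lambda_pos\<close>, and the gap gives the margin.\<close>

lemma Sigma_star_above_lambda_pos:
  assumes "t0 \<in> {T1..T2}" "0 < m t0"
  obtains \<epsilon> where "0 < \<epsilon>"
    "\<And>a b \<kappa>. \<lbrakk>(a, b) \<in> Sigma_star T1 T2 p q m; \<kappa> \<in> {a, b}; 0 \<le> \<kappa> \<or> (\<forall>t\<in>{T1..T2}. 0 \<le> m t)\<rbrakk>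
       \<Longrightarrow> lambda_pos T1 T2 p q m + \<epsilon> < \<kappa>"
proof -
  let ?l = "lambda_pos T1 T2 p q m"
  have l: "subcritical ?l" using lambda_pos[OF assms] by blast
  obtain \<epsilon> where \<epsilon>: "0 < \<epsilon>"
    "\<And>a b \<kappa>. \<lbrakk>(a, b) \<in> Sigma_star T1 T2 p q m; \<kappa> \<in> {a, b}\<rbrakk> \<Longrightarrow> \<not> subcritical \<kappa> \<and> \<epsilon> < \<bar>\<kappa> - ?l\<bar>"
    using Sigma_star_gap[OF l] by blast
  have zero: "subcritical 0" by (rule subcritical_of_nonpos) simp
  show ?thesis
  proof (rule that[OF \<epsilon>(1)])
    fix a b \<kappa> assume "(a, b) \<in> Sigma_star T1 T2 p q m" "\<kappa> \<in> {a, b}"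
      and sgn: "0 \<le> \<kappa> \<or> (\<forall>t\<in>{T1..T2}. 0 \<le> m t)"
    then have *: "\<not> subcritical \<kappa>" "\<epsilon> < \<bar>\<kappa> - ?l\<bar>" using \<epsilon>(2) by blast+
    have "0 \<le> \<kappa>" using sgn *(1) subcritical_of_nonpos[of \<kappa>] by (force simp: mult_nonpos_nonneg)
    then have "?l < \<kappa>" using subcritical_between[OF zero l] *(1) by (meson not_le)
    then show "?l + \<epsilon> < \<kappa>" using *(2) by simp
  qed
qed

lemma Sigma_star_below_lambda_neg:
  assumes "t0 \<in> {T1..T2}" "m t0 < 0"
  obtains \<epsilon> where "0 < \<epsilon>"
    "\<And>a b \<kappa>. \<lbrakk>(a, b) \<in> Sigma_star T1 T2 p q m; \<kappa> \<in> {a, b}; \<kappa> \<le> 0 \<or> (\<forall>t\<in>{T1..T2}. m t \<le> 0)\<rbrakk>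
       \<Longrightarrow> \<kappa> < lambda_neg T1 T2 p q m - \<epsilon>"
proof -
  let ?l = "lambda_neg T1 T2 p q m"
  have l: "subcritical ?l" using lambda_neg[OF assms] by blast
  obtain \<epsilon> where \<epsilon>: "0 < \<epsilon>"
    "\<And>a b \<kappa>. \<lbrakk>(a, b) \<in> Sigma_star T1 T2 p q m; \<kappa> \<in> {a, b}\<rbrakk> \<Longrightarrow> \<not> subcritical \<kappa> \<and> \<epsilon> < \<bar>\<kappa> - ?l\<bar>"
    using Sigma_star_gap[OF l] by blast
  have zero: "subcritical 0" by (rule subcritical_of_nonpos) simp
  show ?thesis
  proof (rule that[OF \<epsilon>(1)])
    fix a b \<kappa> assume "(a, b) \<in> Sigma_star T1 T2 p q m" "\<kappa> \<in> {a, b}"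
      and sgn: "\<kappa> \<le> 0 \<or> (\<forall>t\<in>{T1..T2}. m t \<le> 0)"
    then have *: "\<not> subcritical \<kappa>" "\<epsilon> < \<bar>\<kappa> - ?l\<bar>" using \<epsilon>(2) by blast+
    have "\<kappa> \<le> 0" using sgn *(1) subcritical_of_nonpos[of \<kappa>] by (force simp: mult_nonneg_nonpos)
    then have "\<kappa> < ?l" using subcritical_between[OF l zero] *(1) by (meson not_le)
    then show "\<kappa> < ?l - \<epsilon>" using *(2) by simp
  qed
qed

end

theorem corollary4p1:
  fixes T1 T2 :: real and p q m :: "real \<Rightarrow> real"
  assumes "T1 < T2"
    and "continuous_on {T1..T2} p" and "continuous_on {T1..T2} q" and "continuous_on {T1..T2} m"
    and "\<forall>t\<in>{T1..T2}. p t > 0" and "\<forall>t\<in>{T1..T2}. q t \<ge> 0"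
    and "not_identically_zero T1 T2 m"
  defines "l1 \<equiv> lambda_pos T1 T2 p q m" and "l_1 \<equiv> lambda_neg T1 T2 p q m"
  shows "(changes_sign T1 T2 m \<longrightarrow>
            (\<exists>\<epsilon>>0. Sigma_star T1 T2 p q m \<subseteq>
               ({l1 + \<epsilon> <..} \<times> {l1 + \<epsilon> <..}) \<union> ({..< l_1 - \<epsilon>} \<times> {..< l_1 - \<epsilon>}) \<union>
               ({..< l_1 - \<epsilon>} \<times> {l1 + \<epsilon> <..}) \<union> ({l1 + \<epsilon> <..} \<times> {..< l_1 - \<epsilon>}))) \<and>
         ((\<forall>t\<in>{T1..T2}. m t \<ge> 0) \<longrightarrow>
            (\<exists>\<epsilon>>0. Sigma_star T1 T2 p q m \<subseteq> {l1 + \<epsilon> <..} \<times> {l1 + \<epsilon> <..})) \<and>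
         ((\<forall>t\<in>{T1..T2}. m t \<le> 0) \<longrightarrow>
            (\<exists>\<epsilon>>0. Sigma_star T1 T2 p q m \<subseteq> {..< l_1 - \<epsilon>} \<times> {..< l_1 - \<epsilon>}))"
proof -
  interpret neumann_data T1 T2 p q m using assms by unfold_locales auto
  note above = Sigma_star_above_lambda_pos[folded l1_def]
    and below = Sigma_star_below_lambda_neg[folded l_1_def]
  show ?thesis
  proof (intro conjI impI)
    assume "changes_sign T1 T2 m"
    then obtain s t where s: "s \<in> {T1..T2}" "0 < m s" and t: "t \<in> {T1..T2}" "m t < 0"
      unfolding changes_sign_def not_identically_zero_def pos_part_def neg_part_def
      by (force simp: max_def split: if_splits)
    obtain \<epsilon>1 where e1: "0 < \<epsilon>1"
      "\<And>a b \<kappa>. \<lbrakk>(a, b) \<in> Sigma_star T1 T2 p q m; \<kappa> \<in> {a, b}; 0 \<le> \<kappa> \<or> (\<forall>t\<in>{T1..T2}. 0 \<le> m t)\<rbrakk>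
         \<Longrightarrow> l1 + \<epsilon>1 < \<kappa>"
      using above[OF s] by blast
    obtain \<epsilon>2 where e2: "0 < \<epsilon>2"
      "\<And>a b \<kappa>. \<lbrakk>(a, b) \<in> Sigma_star T1 T2 p q m; \<kappa> \<in> {a, b}; \<kappa> \<le> 0 \<or> (\<forall>t\<in>{T1..T2}. m t \<le> 0)\<rbrakk>
         \<Longrightarrow> \<kappa> < l_1 - \<epsilon>2"
      using below[OF t] by blast
    define \<epsilon> where "\<epsilon> = min \<epsilon>1 \<epsilon>2"
    \<comment> \<open>Distinguishing the sign of \<open>\<kappa>\<close> puts each coordinate into
      one of two rays; the combinations for \<open>a\<close> and \<open>b\<close> are the four
      products.\<close>
    have gap: "l1 + \<epsilon> < \<kappa> \<or> \<kappa> < l_1 - \<epsilon>"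
      if "(a, b) \<in> Sigma_star T1 T2 p q m" "\<kappa> \<in> {a, b}" for a b \<kappa>
      using e1(2)[OF that] e2(2)[OF that] unfolding \<epsilon>_def by linarith
    have "x \<in> ({l1 + \<epsilon> <..} \<times> {l1 + \<epsilon> <..}) \<union> ({..< l_1 - \<epsilon>} \<times> {..< l_1 - \<epsilon>}) \<union>
               ({..< l_1 - \<epsilon>} \<times> {l1 + \<epsilon> <..}) \<union> ({l1 + \<epsilon> <..} \<times> {..< l_1 - \<epsilon>})"
      if x: "x \<in> Sigma_star T1 T2 p q m" for x
    proof (cases x)
      case (Pair a b)
      with x show ?thesis using gap[of a b a] gap[of a b b] by simp blast
    qed
    moreover have "0 < \<epsilon>" using e1(1) e2(1) by (simp add: \<epsilon>_def)
    ultimately show "\<exists>\<epsilon>>0. Sigma_star T1 T2 p q m \<subseteq>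
               ({l1 + \<epsilon> <..} \<times> {l1 + \<epsilon> <..}) \<union> ({..< l_1 - \<epsilon>} \<times> {..< l_1 - \<epsilon>}) \<union>
               ({..< l_1 - \<epsilon>} \<times> {l1 + \<epsilon> <..}) \<union> ({l1 + \<epsilon> <..} \<times> {..< l_1 - \<epsilon>})"
      by blast
  next
    assume m: "\<forall>t\<in>{T1..T2}. m t \<ge> 0"
    with assms(7) obtain s where "s \<in> {T1..T2}" "0 < m s"
      unfolding not_identically_zero_def by force
    then obtain \<epsilon> where "0 < \<epsilon>"
      "\<And>a b \<kappa>. \<lbrakk>(a, b) \<in> Sigma_star T1 T2 p q m; \<kappa> \<in> {a, b}; 0 \<le> \<kappa> \<or> (\<forall>t\<in>{T1..T2}. 0 \<le> m t)\<rbrakk>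
         \<Longrightarrow> l1 + \<epsilon> < \<kappa>"
      using above by blast
    with m show "\<exists>\<epsilon>>0. Sigma_star T1 T2 p q m \<subseteq> {l1 + \<epsilon> <..} \<times> {l1 + \<epsilon> <..}"
      by (intro exI[of _ \<epsilon>]) auto
  next
    assume m: "\<forall>t\<in>{T1..T2}. m t \<le> 0"
    with assms(7) obtain s where "s \<in> {T1..T2}" "m s < 0"
      unfolding not_identically_zero_def by force
    then obtain \<epsilon> where "0 < \<epsilon>"
      "\<And>a b \<kappa>. \<lbrakk>(a, b) \<in> Sigma_star T1 T2 p q m; \<kappa> \<in> {a, b}; \<kappa> \<le> 0 \<or> (\<forall>t\<in>{T1..T2}. m t \<le> 0)\<rbrakk>
         \<Longrightarrow> \<kappa> < l_1 - \<epsilon>"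
      using below by blast
    with m show "\<exists>\<epsilon>>0. Sigma_star T1 T2 p q m \<subseteq> {..< l_1 - \<epsilon>} \<times> {..< l_1 - \<epsilon>}"
      by (intro exI[of _ \<epsilon>]) auto
  qed
qed

end
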